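(* Let $M^{[*]}$ be a dg module for a dg vertex algebra $V^{[*]}$. Then $R^{[*]}(M^{[*]})=M^{[*]}/C_2^{[*]}(M^{[*]})$, with $\overline v\cdot\overline m=\overline{v_{-1}m}$ and $\{\overline v,\overline m\}_{R(M)}=\overline{v_0m}$, is a dg Poisson module for the dg Poisson algebra $R^{[*]}(V^{[*]})$. If $V^{[*]}$ is a dg vertex operator algebra and $M^{[*]}=\bigoplus_{n\in\frac12\mathbb Z}M^{[*]}(n)$ is a graded dg $V^{[*]}$-module, then $R^{[*]}(M^{[*]})$ is also a $\mathbb Z\times\frac12\mathbb Z$-graded module for $R^{[*]}(V^{[*]})$.
   Context: All vector spaces are over $\mathbb C$. A (cochain) complex $V^{[*]}=\bigoplus_{p\in\mathbb Z}V^{[p]}$ has a differential $d_V$ of degree $+1$ with $d_V^2=0$; $|v|=p$ for $v\in V^{[p]}$. $\operatorname{End}^{[*]}(V^{[*]})=\bigoplus_p\operatorname{End}^{[p]}(V^{[*]})$, where $\operatorname{End}^{[p]}$ is the space of linear maps of degree $p$. A dg vertex algebra $(V^{[*]},d_V,Y(\cdot,x),\mathbf 1)$ is a complex with a linear map $v\mapsto Y(v,x)=\sum_{n\in\mathbb Z}v_nx^{-n-1}\in\operatorname{End}^{[*]}(V^{[*]})[[x,x^{-1}]]$ such that for $v\in V^{[p]}$ one has $v_n\in\operatorname{End}^{[p-2n-2]}(V^{[*]})$ and $(d_Vv)_n=d_V\circ v_n-(-1)^{p}v_n\circ d_V$, and a vector $\mathbf 1\in V^{[0]}$ with $d_V\mathbf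 1=0$, such that: $u_nv=0$ for $n$ sufficiently large; $Y(\mathbf 1,x)=\operatorname{id}$; $Y(v,x)\mathbf 1\in V^{[*]}[[x]]$ with constant term $v$; and (Jacobi identity) for homogeneous $u,v$ and all $l,m,n\in\mathbb Z$, $$\sum_{i\ge0}(-1)^i\binom li\left(u_{m+l-i}v_{n+i}-(-1)^{l}(-1)^{|u||v|}v_{n+l-i}u_{m+i}\right)=\sum_{i\ge0}\binom mi(u_{l+i}v)_{m+n-i}.$$ A dg vertex operator algebra is a dg vertex algebra with $\omega\in V^{[4]}$, $d_V\omega=0$, such that, writing $Y(\omega,x)=\sum_nL(n)x^{-n-2}$: $[L(m),L(n)]=(m-n)L(m+n)+\frac1{12}(m^3-m)\delta_{m+n,0}c_V$ for some $c_V\in\mathbb C$; $L(0)$ is semisimple with $V^{[*]}=\bigoplus_{n\in\frac12\mathbb Z}V_n^{[*]}$, $V_n^{[*]}$ the eigenspace of eigenvalue (weight) $n$, $\omega\in V_2^{[*]}$, $\dim V_n^{[*]}<\infty$, $V_n^{[*]}=0$ for $n\ll0$; and $L(-1)v=v_{-2}\mathbf 1$. Put $V_n^{[p]}=V_n^{[*]}\cap V^{[p]}$. A dg module over $V^{[*]}$ is a complex $(M^{[*]},d_M)$ with a linear map $v\mapsto Y_M(v,x)=\sum_nv_nx^{-n-1}\in\operatorname{End}^{[*]}(M^{[*]})[[x,x^{-1}]]$ such that for $v\in V^{[p]}$, $v_n\in\operatorname{End}^{[p-2n-2]}(M^{[*]})$ and $(d_Vv)_n=d_M\circ v_n-(-1)^pv_n\circ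 d_M$; $v_nm=0$ for $n$ sufficiently large; $Y_M(\mathbf 1,x)=\operatorname{id}$; and the displayed Jacobi identity holds for operators on $M^{[*]}$. A graded dg module over a dg vertex operator algebra is a dg module with a decomposition $M^{[*]}=\bigoplus_{n\in\frac12\mathbb Z}M^{[*]}(n)$ into subcomplexes such that $u_m(M^{[*]}(r))\subseteq M^{[*]}(r+n-m-1)$ for $u\in V_n^{[*]}$, $m\in\mathbb Z$, $r\in\frac12\mathbb Z$. $C_2^{[*]}(V^{[*]})=\operatorname{Span}\{u_{-2}v\}$, $R^{[*]}(V^{[*]})=V^{[*]}/C_2^{[*]}(V^{[*]})$, a graded commutative dg Poisson algebra with product $\overline u\cdot\overline v=\overline{u_{-1}v}$ and bracket $\{\overline u,\overline v\}_{R(V)}=\overline{u_0v}$ of degree $-2$; in the dg vertex operator algebra case $R^{[p]}(V^{[*]})_n$ is the image of $V_n^{[p]}$. $C_2^{[*]}(M^{[*]})=\operatorname{Span}\{v_{-2}m\mid v\in V^{[*]},m\in M^{[*]}\}$, a subcomplex; bars denote classes. A dg Poisson module over a graded commutative dg Poisson algebra $R^{[*]}$ with bracket of even degree $k$ (here $k=-2$) is a left dg module $M^{[*]}$ over the associative dg algebra $R^{[*]}$ with a bilinear bracket $R^{[p]}\times M^{[q]}\to M^{[p+q+k]}$ such that for homogeneous elements: $\{\{a,b\},m\}=\{a,\{b,m\}\}-(-1)^{|a||b|}\{b,\{a,m\}\}$; $d\{a,m\}=\{da,m\}+(-1)^{|a|}\{a,dm\}$; $\{a,bm\}=\{a,b\}m+(-1)^{|a||b|}b\{a,m\}$;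 $\{ab,m\}=a\{b,m\}+(-1)^{|a||b|}b\{a,m\}$. $\mathbb Z\times\frac12\mathbb Z$-graded module means $R^{[*]}(M^{[*]})=\bigoplus_{p,n}R^{[p]}(M^{[*]})(n)$, with $R^{[p]}(M^{[*]})(n)$ the image of $M^{[p]}(n)$, and $R^{[p]}(V^{[*]})_n\cdot R^{[p']}(M^{[*]})(n')\subseteq R^{[p+p']}(M^{[*]})(n+n')$. *)

theory Defs
  imports Complex_Main "HOL-Library.Groups_Big_Fun" "HOL-Algebra.Module"
begin

text \<open>
  A dg vertex algebra and its module are given on whole types, as instances of the
  \<^locale>\<open>vector_space\<close> locale over the complex numbers.  Quotient spaces depend on such data
  and so are not types; they are \<open>HOL-Algebra\<close> structures whose elements are cosets, and the
  notions of dg Poisson algebra and dg Poisson module are stated for \<open>HOL-Algebra\<close> structures.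
\<close>

section \<open>Complexes, dg vertex algebras and their modules\<close>

definition half_ints :: "rat set" where
  "half_ints = {n. 2 * n \<in> \<int>}"

definition direct_sum ::
  "(complex \<Rightarrow> 'a::ab_group_add \<Rightarrow> 'a) \<Rightarrow> 'i set \<Rightarrow> ('i \<Rightarrow> 'a set) \<Rightarrow> bool" where
  "direct_sum s I A \<longleftrightarrow>
     (\<forall>i\<in>I. module.subspace s (A i)) \<and>
     (\<forall>x. \<exists>!f. (\<forall>i\<in>I. f i \<in> A i) \<and> (\<forall>i. i \<notin> I \<longrightarrow> f i = 0) \<and>
               finite {i. f i \<noteq> 0} \<and> x = Sum_any f)"

locale cochain_complex = vector_space s
  for s :: "complex \<Rightarrow> 'a::ab_group_add \<Rightarrow> 'a" +
  fixes G :: "int \<Rightarrow> 'a set" and d :: "'a \<Rightarrow> 'a"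
  assumes grading: "direct_sum s UNIV G"
    and d_linear: "Vector_Spaces.linear s s d"
    and d_degree: "x \<in> G p \<Longrightarrow> d x \<in> G (p + 1)"
    and d_square: "d (d x) = 0"

definition end_degree ::
  "(complex \<Rightarrow> 'a::ab_group_add \<Rightarrow> 'a) \<Rightarrow> (int \<Rightarrow> 'a set) \<Rightarrow> int \<Rightarrow> ('a \<Rightarrow> 'a) set" where
  "end_degree s G p = {f. Vector_Spaces.linear s s f \<and> (\<forall>q. f ` G q \<subseteq> G (q + p))}"

text \<open>
  The axioms on vertex operators that a dg vertex algebra (acting on itself) and a dg module have
  in common; \<open>YM v n\<close> is the mode \<open>v\<^sub>n\<close>, the coefficient of \<open>x\<close> to the power \<open>-n-1\<close>.
  In the Jacobi identity \<^const>\<open>Sum_any\<close> is the sum over the support of the summand, which is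
  finite by truncation.
\<close>

locale vertex_operators =
  V: cochain_complex sV VG dV + M: cochain_complex sM MG dM
  for sV :: "complex \<Rightarrow> 'v::ab_group_add \<Rightarrow> 'v" and VG dV
    and sM :: "complex \<Rightarrow> 'm::ab_group_add \<Rightarrow> 'm" and MG dM +
  fixes Y :: "'v \<Rightarrow> int \<Rightarrow> 'v \<Rightarrow> 'v" and vac :: 'v
    and YM :: "'v \<Rightarrow> int \<Rightarrow> 'm \<Rightarrow> 'm"
  assumes modes_linear: "Vector_Spaces.linear sM sM (YM v n)"
    and modes_linear_left: "Vector_Spaces.linear sV sM (\<lambda>v. YM v n w)"
    and modes_degree: "v \<in> VG p \<Longrightarrow> YM v n \<in> end_degree sM MG (p - 2 * n - 2)"
    and modes_d: "v \<in> VG p \<Longrightarrow>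
      YM (dV v) n w = dM (YM v n w) - sM ((-1) powi p) (YM v n (dM w))"
    and truncation: "\<exists>N. \<forall>n\<ge>N. YM v n w = 0"
    and vacuum: "YM vac n w = (if n = -1 then w else 0)"
    and jacobi: "u \<in> VG p \<Longrightarrow> v \<in> VG q \<Longrightarrow>
      Sum_any (\<lambda>i::nat. sM ((-1) ^ i * (of_int l gchoose i))
        (YM u (m + l - int i) (YM v (n + int i) w)
         - sM ((-1) powi l * (-1) powi (p * q))
             (YM v (n + l - int i) (YM u (m + int i) w))))
      = Sum_any (\<lambda>i::nat. sM (of_int m gchoose i)
          (YM (Y u (l + int i) v) (m + n - int i) w))"

locale dg_vertex_algebra = vertex_operators sV VG dV sV VG dV Y vac Y
  for sV :: "complex \<Rightarrow> 'v::ab_group_add \<Rightarrow> 'v" and VG dV Y vac +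
  assumes vac_degree: "vac \<in> VG 0"
    and vac_closed: "dV vac = 0"
    and creation: "n \<ge> 0 \<Longrightarrow> Y v n vac = 0" "Y v (-1) vac = v"

locale dg_module =
  dg_vertex_algebra sV VG dV Y vac + action: vertex_operators sV VG dV sM MG dM Y vac YM
  for sV :: "complex \<Rightarrow> 'v::ab_group_add \<Rightarrow> 'v" and VG dV Y vac
    and sM :: "complex \<Rightarrow> 'm::ab_group_add \<Rightarrow> 'm" and MG dM YM

definition weight_space ::
  "(complex \<Rightarrow> 'v \<Rightarrow> 'v) \<Rightarrow> ('v \<Rightarrow> int \<Rightarrow> 'v \<Rightarrow> 'v) \<Rightarrow> 'v \<Rightarrow> rat \<Rightarrow> 'v set" where
  "weight_space sV Y \<omega> n = {v. Y \<omega> 1 v = sV (of_rat n) v}"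

text \<open>Here \<open>L(n)\<close> is \<open>Y \<omega> (n + 1)\<close>.\<close>

locale dg_vertex_operator_algebra = dg_vertex_algebra sV VG dV Y vac
  for sV :: "complex \<Rightarrow> 'v::ab_group_add \<Rightarrow> 'v" and VG dV Y vac +
  fixes \<omega> :: 'v
  assumes omega_degree: "\<omega> \<in> VG 4"
    and omega_closed: "dV \<omega> = 0"
    and virasoro: "\<exists>c::complex. \<forall>m n v.
      Y \<omega> (m + 1) (Y \<omega> (n + 1) v) - Y \<omega> (n + 1) (Y \<omega> (m + 1) v) =
      sV (of_int (m - n)) (Y \<omega> (m + n + 1) v)
      + sV (if m + n = 0 then of_int (m ^ 3 - m) / 12 * c else 0) v"
    and weight_decomposition: "direct_sum sV half_ints (weight_space sV Y \<omega>)"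
    and omega_weight: "\<omega> \<in> weight_space sV Y \<omega> 2"
    and weight_finite_dim: "n \<in> half_ints \<Longrightarrow>
      \<exists>B. finite B \<and> weight_space sV Y \<omega> n \<subseteq> module.span sV B"
    and weight_bounded_below: "\<exists>N. \<forall>n\<in>half_ints. n < N \<longrightarrow> weight_space sV Y \<omega> n = {0}"
    and translation: "Y \<omega> 0 v = Y v (-2) vac"

text \<open>
  \<open>MW_graded\<close> and \<open>MW_d\<close> together say that each \<open>MW r\<close> is a subcomplex: a graded subspace that
  is stable under the differential.
\<close>

locale graded_dg_module =
  dg_vertex_operator_algebra sV VG dV Y vac \<omega> + dg_module sV VG dV Y vac sM MG dM YM
  for sV :: "complex \<Rightarrow> 'v::ab_group_add \<Rightarrow> 'v" and VG dV Y vac \<omega>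
    and sM :: "complex \<Rightarrow> 'm::ab_group_add \<Rightarrow> 'm" and MG dM YM +
  fixes MW :: "rat \<Rightarrow> 'm set"
  assumes MW_decomposition: "direct_sum sM half_ints MW"
    and MW_graded: "r \<in> half_ints \<Longrightarrow> MW r \<subseteq> module.span sM (\<Union>p. MW r \<inter> MG p)"
    and MW_d: "r \<in> half_ints \<Longrightarrow> dM ` MW r \<subseteq> MW r"
    and MW_modes: "n \<in> half_ints \<Longrightarrow> r \<in> half_ints \<Longrightarrow> u \<in> weight_space sV Y \<omega> n \<Longrightarrow>
      YM u m ` MW r \<subseteq> MW (r + n - of_int m - 1)"


section \<open>DG Poisson algebras and modules\<close>

definition complex_ring :: "complex ring" where
  "complex_ring = \<lparr>carrier = UNIV, mult = (*), one = 1, zero = 0, add = (+)\<rparr>"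

definition direct_sum_on ::
  "(complex, 'a, 'x) module_scheme \<Rightarrow> 'i set \<Rightarrow> ('i \<Rightarrow> 'a set) \<Rightarrow> bool" where
  "direct_sum_on A I G \<longleftrightarrow>
     (\<forall>i\<in>I. submodule (G i) complex_ring A) \<and>
     (\<forall>x\<in>carrier A. \<exists>!f. (\<forall>i\<in>I. f i \<in> G i) \<and> (\<forall>i. i \<notin> I \<longrightarrow> f i = \<zero>\<^bsub>A\<^esub>) \<and>
               finite {i. f i \<noteq> \<zero>\<^bsub>A\<^esub>} \<and> x = finsum A f {i. f i \<noteq> \<zero>\<^bsub>A\<^esub>})"

definition linear_on ::
  "(complex, 'a, 'x) module_scheme \<Rightarrow> (complex, 'b, 'y) module_scheme \<Rightarrow> ('a \<Rightarrow> 'b) \<Rightarrow> bool" where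
  "linear_on A B f \<longleftrightarrow>
     f \<in> carrier A \<rightarrow> carrier B \<and>
     (\<forall>x\<in>carrier A. \<forall>y\<in>carrier A. f (x \<oplus>\<^bsub>A\<^esub> y) = f x \<oplus>\<^bsub>B\<^esub> f y) \<and>
     (\<forall>c. \<forall>x\<in>carrier A. f (c \<odot>\<^bsub>A\<^esub> x) = c \<odot>\<^bsub>B\<^esub> f x)"

definition bilinear_on ::
  "(complex, 'a, 'x) module_scheme \<Rightarrow> (complex, 'b, 'y) module_scheme \<Rightarrow>
   (complex, 'c, 'z) module_scheme \<Rightarrow> ('a \<Rightarrow> 'b \<Rightarrow> 'c) \<Rightarrow> bool" where
  "bilinear_on A B C f \<longleftrightarrow>
     (\<forall>x\<in>carrier A. linear_on B C (f x)) \<and> (\<forall>y\<in>carrier B. linear_on A C (\<lambda>x. f x y))"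

locale complex_on = Module.module complex_ring A
  for A :: "(complex, 'a, 'x) module_scheme" +
  fixes G :: "int \<Rightarrow> 'a set" and d :: "'a \<Rightarrow> 'a"
  assumes grading: "direct_sum_on A UNIV G"
    and d_linear: "linear_on A A d"
    and d_degree: "x \<in> G p \<Longrightarrow> d x \<in> G (p + 1)"
    and d_square: "x \<in> carrier A \<Longrightarrow> d (d x) = \<zero>\<^bsub>A\<^esub>"

locale dg_algebra = complex_on R RG dR + ring R
  for R :: "(complex, 'a, 'x) module_scheme" and RG dR +
  assumes mult_bilinear: "bilinear_on R R R (\<lambda>a b. a \<otimes>\<^bsub>R\<^esub> b)"
    and one_degree: "\<one>\<^bsub>R\<^esub> \<in> RG 0"
    and mult_degree: "a \<in> RG p \<Longrightarrow> b \<in> RG q \<Longrightarrow> a \<otimes>\<^bsub>R\<^esub> b \<in> RG (p + q)"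
    and d_mult: "a \<in> RG p \<Longrightarrow> b \<in> RG q \<Longrightarrow>
      dR (a \<otimes>\<^bsub>R\<^esub> b) = dR a \<otimes>\<^bsub>R\<^esub> b \<oplus>\<^bsub>R\<^esub> ((-1) powi p) \<odot>\<^bsub>R\<^esub> (a \<otimes>\<^bsub>R\<^esub> dR b)"

text \<open>Graded commutative dg Poisson algebras with bracket of even degree \<open>k\<close>.\<close>

locale dg_poisson_algebra = dg_algebra R RG dR
  for R :: "(complex, 'a, 'x) module_scheme" and RG dR +
  fixes k :: int and br :: "'a \<Rightarrow> 'a \<Rightarrow> 'a"
  assumes even_degree: "even k"
    and graded_commutative: "a \<in> RG p \<Longrightarrow> b \<in> RG q \<Longrightarrow>
      a \<otimes>\<^bsub>R\<^esub> b = ((-1) powi (p * q)) \<odot>\<^bsub>R\<^esub> (b \<otimes>\<^bsub>R\<^esub> a)"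
    and br_bilinear: "bilinear_on R R R br"
    and br_degree: "a \<in> RG p \<Longrightarrow> b \<in> RG q \<Longrightarrow> br a b \<in> RG (p + q + k)"
    and br_antisym: "a \<in> RG p \<Longrightarrow> b \<in> RG q \<Longrightarrow>
      br a b = \<ominus>\<^bsub>R\<^esub> (((-1) powi (p * q)) \<odot>\<^bsub>R\<^esub> br b a)"
    and br_jacobi: "a \<in> RG p \<Longrightarrow> b \<in> RG q \<Longrightarrow> c \<in> RG r \<Longrightarrow>
      br (br a b) c = br a (br b c) \<ominus>\<^bsub>R\<^esub> ((-1) powi (p * q)) \<odot>\<^bsub>R\<^esub> br b (br a c)"
    and d_br: "a \<in> RG p \<Longrightarrow> b \<in> RG q \<Longrightarrow>
      dR (br a b) = br (dR a) b \<oplus>\<^bsub>R\<^esub> ((-1) powi p) \<odot>\<^bsub>R\<^esub> br a (dR b)"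
    and br_leibniz: "a \<in> RG p \<Longrightarrow> b \<in> RG q \<Longrightarrow> c \<in> RG r \<Longrightarrow>
      br a (b \<otimes>\<^bsub>R\<^esub> c) =
        br a b \<otimes>\<^bsub>R\<^esub> c \<oplus>\<^bsub>R\<^esub> ((-1) powi (p * q)) \<odot>\<^bsub>R\<^esub> (b \<otimes>\<^bsub>R\<^esub> br a c)"

locale dg_poisson_module =
  dg_poisson_algebra R RG dR k br + M: complex_on M MG dM
  for R :: "(complex, 'a, 'x) module_scheme" and RG dR k br
    and M :: "(complex, 'm, 'y) module_scheme" and MG dM +
  fixes act :: "'a \<Rightarrow> 'm \<Rightarrow> 'm" and brM :: "'a \<Rightarrow> 'm \<Rightarrow> 'm"
  assumes act_bilinear: "bilinear_on R M M act"
    and act_one: "x \<in> carrier M \<Longrightarrow> act \<one>\<^bsub>R\<^esub> x = x"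
    and act_assoc: "a \<in> carrier R \<Longrightarrow> b \<in> carrier R \<Longrightarrow> x \<in> carrier M \<Longrightarrow>
      act (a \<otimes>\<^bsub>R\<^esub> b) x = act a (act b x)"
    and act_degree: "a \<in> RG p \<Longrightarrow> x \<in> MG q \<Longrightarrow> act a x \<in> MG (p + q)"
    and d_act: "a \<in> RG p \<Longrightarrow> x \<in> MG q \<Longrightarrow>
      dM (act a x) = act (dR a) x \<oplus>\<^bsub>M\<^esub> ((-1) powi p) \<odot>\<^bsub>M\<^esub> act a (dM x)"
    and brM_bilinear: "bilinear_on R M M brM"
    and brM_degree: "a \<in> RG p \<Longrightarrow> x \<in> MG q \<Longrightarrow> brM a x \<in> MG (p + q + k)"
    and brM_jacobi: "a \<in> RG p \<Longrightarrow> b \<in> RG q \<Longrightarrow> x \<in> MG r \<Longrightarrow>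
      brM (br a b) x = brM a (brM b x) \<ominus>\<^bsub>M\<^esub> ((-1) powi (p * q)) \<odot>\<^bsub>M\<^esub> brM b (brM a x)"
    and d_brM: "a \<in> RG p \<Longrightarrow> x \<in> MG q \<Longrightarrow>
      dM (brM a x) = brM (dR a) x \<oplus>\<^bsub>M\<^esub> ((-1) powi p) \<odot>\<^bsub>M\<^esub> brM a (dM x)"
    and brM_act: "a \<in> RG p \<Longrightarrow> b \<in> RG q \<Longrightarrow> x \<in> MG r \<Longrightarrow>
      brM a (act b x) = act (br a b) x \<oplus>\<^bsub>M\<^esub> ((-1) powi (p * q)) \<odot>\<^bsub>M\<^esub> act b (brM a x)"
    and brM_mult: "a \<in> RG p \<Longrightarrow> b \<in> RG q \<Longrightarrow> x \<in> MG r \<Longrightarrow>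
      brM (a \<otimes>\<^bsub>R\<^esub> b) x =
        act a (brM b x) \<oplus>\<^bsub>M\<^esub> ((-1) powi (p * q)) \<odot>\<^bsub>M\<^esub> act b (brM a x)"

text \<open>\<open>RG p n\<close> and \<open>MG p n\<close> are the pieces of degree \<open>p\<close> and weight \<open>n\<close>.\<close>

definition bigraded_module ::
  "(int \<Rightarrow> rat \<Rightarrow> 'a set) \<Rightarrow> (complex, 'm, 'y) module_scheme \<Rightarrow> (int \<Rightarrow> rat \<Rightarrow> 'm set) \<Rightarrow>
   ('a \<Rightarrow> 'm \<Rightarrow> 'm) \<Rightarrow> bool" where
  "bigraded_module RG M MG act \<longleftrightarrow>
     direct_sum_on M (UNIV \<times> half_ints) (\<lambda>(p, n). MG p n) \<and>
     (\<forall>p p'. \<forall>n\<in>half_ints. \<forall>n'\<in>half_ints. \<forall>a\<in>RG p n. \<forall>x\<in>MG p' n'.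
        act a x \<in> MG (p + p') (n + n'))"


section \<open>The quotient by \<open>C\<^sub>2\<close>\<close>

definition coset :: "'a::plus set \<Rightarrow> 'a \<Rightarrow> 'a set" where
  "coset W x = (\<lambda>w. x + w) ` W"

text \<open>
  Maps induced on cosets, in the style of \<open>rcoset_mult\<close> in \<open>HOL-Algebra\<close>: the union over all representatives
  is a single coset exactly when the induced map is well defined.
\<close>

definition induced :: "'b::plus set \<Rightarrow> ('a \<Rightarrow> 'b) \<Rightarrow> 'a set \<Rightarrow> 'b set" where
  "induced W f A = (\<Union>x\<in>A. coset W (f x))"

definition induced2 :: "'c::plus set \<Rightarrow> ('a \<Rightarrow> 'b \<Rightarrow> 'c) \<Rightarrow> 'a set \<Rightarrow> 'b set \<Rightarrow> 'c set" where
  "induced2 W f A B = (\<Union>x\<in>A. \<Union>y\<in>B. coset W (f x y))"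

definition C2 ::
  "(complex \<Rightarrow> 'm::ab_group_add \<Rightarrow> 'm) \<Rightarrow> ('v \<Rightarrow> int \<Rightarrow> 'm \<Rightarrow> 'm) \<Rightarrow> 'm set" where
  "C2 s Y = module.span s {Y v (-2) w | v w. True}"

text \<open>
  The space \<open>R(M)\<close>; a \<open>HOL-Algebra\<close> module record carries multiplicative fields, which are not
  used for a module.
\<close>

definition R_module ::
  "(complex \<Rightarrow> 'm::ab_group_add \<Rightarrow> 'm) \<Rightarrow> ('v \<Rightarrow> int \<Rightarrow> 'm \<Rightarrow> 'm) \<Rightarrow> (complex, 'm set) module" where
  "R_module s Y =
     \<lparr>carrier = range (coset (C2 s Y)), mult = undefined, one = undefined,
      zero = C2 s Y, add = induced2 (C2 s Y) (+), smult = (\<lambda>c. induced (C2 s Y) (s c))\<rparr>"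

definition R_op ::
  "(complex \<Rightarrow> 'm::ab_group_add \<Rightarrow> 'm) \<Rightarrow> ('v \<Rightarrow> int \<Rightarrow> 'm \<Rightarrow> 'm) \<Rightarrow> int \<Rightarrow>
   'v set \<Rightarrow> 'm set \<Rightarrow> 'm set" where
  "R_op s Y n = induced2 (C2 s Y) (\<lambda>v w. Y v n w)"

definition R_algebra ::
  "(complex \<Rightarrow> 'v::ab_group_add \<Rightarrow> 'v) \<Rightarrow> ('v \<Rightarrow> int \<Rightarrow> 'v \<Rightarrow> 'v) \<Rightarrow> 'v \<Rightarrow>
   (complex, 'v set) module" where
  "R_algebra s Y vac =
     (R_module s Y)\<lparr>mult := R_op s Y (-1), one := coset (C2 s Y) vac\<rparr>"

definition R_image ::
  "(complex \<Rightarrow> 'm::ab_group_add \<Rightarrow> 'm) \<Rightarrow> ('v \<Rightarrow> int \<Rightarrow> 'm \<Rightarrow> 'm) \<Rightarrow> 'm set \<Rightarrow> 'm set set" where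
  "R_image s Y S = coset (C2 s Y) ` S"

end

theory Submission
  imports Defs
begin

text \<open>
  The class of \<open>v\<^sub>nm\<close> depends only on the classes of \<open>v\<close> and \<open>m\<close> for every \<open>n \<le> 0\<close>, and all
  identities of a Poisson module are special cases of the Jacobi identity in which almost all
  terms lie in \<open>C\<^sub>2(M)\<close>.  The reason is that \<open>v\<^sub>nm\<close> lies in \<open>C\<^sub>2(M)\<close> not only for \<open>n = -2\<close> but
  for all \<open>n \<le> -2\<close> (\<open>mode_mem_C2\<close>), because lower modes are, up to nonzero factors, modes of
  translates of \<open>v\<close>.

  Two specializations of the Jacobi identity carry the argument.  The commutator formula
  (\<open>l = 0\<close>) shows that modes of nonpositive index preserve \<open>C\<^sub>2(M)\<close>, and for the zero mode it is
  already the Jacobi identity of the bracket and the Leibniz rule in its second argument.  The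
  associativity formula (\<open>m = 0\<close>) shows that modes of nonpositive index of elements of \<open>C\<^sub>2(V)\<close>
  map all of \<open>M\<close> to \<open>C\<^sub>2(M)\<close>, and for the product \<open>u\<^sub>-\<^sub>1v\<close> its leading term gives the associativity
  of the action and the Leibniz rule in the first argument (\<open>product_mode\<close>).  The algebra is a
  module over itself; what is special to it,
  the commutativity of the product and the antisymmetry of the bracket, comes from applying the
  Jacobi identity to the vacuum.  These formulas hold for vectors of pure degree, and
  well-definedness and associativity extend to all vectors by linearity.

  A grading descends to the quotient by a subspace if the subspace contains all components of its
  elements (\<open>direct_sum_on_quotient\<close>), and a span of elements of pure degree has this property
  (\<open>homogeneous_span\<close>).  Since \<open>C\<^sub>2(M)\<close> is spanned by \<open>v\<^sub>-\<^sub>2m\<close> with \<open>v\<close> and \<open>m\<close> homogeneous, for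
  the degree as well as for the weight, it is compatible with both gradings.  The two gradings of
  \<open>M\<close> have a common refinement because each weight space is graded by degree, and a subspace
  compatible with both gradings is compatible with the refinement (\<open>homogeneous_product\<close>).
\<close>

section \<open>Gradings and homogeneous subspaces\<close>

definition decomposition :: "'i set \<Rightarrow> ('i \<Rightarrow> 'a::ab_group_add set) \<Rightarrow> ('i \<Rightarrow> 'a) \<Rightarrow> bool" where
  "decomposition I A f \<longleftrightarrow>
     (\<forall>i\<in>I. f i \<in> A i) \<and> (\<forall>i. i \<notin> I \<longrightarrow> f i = 0) \<and> finite {i. f i \<noteq> 0}"

text \<open>
Formulated by decompositions and not by projections, so that it makes sense before the sum of the
pieces is known to be direct; for \<open>W = {0}\<close> it is the independence of the pieces.
\<close>

definition homogeneous :: "'i set \<Rightarrow> ('i \<Rightarrow> 'a::ab_group_add set) \<Rightarrow> 'a set \<Rightarrow> bool" where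
  "homogeneous I A W \<longleftrightarrow> (\<forall>f. decomposition I A f \<longrightarrow> Sum_any f \<in> W \<longrightarrow> (\<forall>i. f i \<in> W))"

lemma direct_sum_alt:
  "direct_sum s I A \<longleftrightarrow>
     (\<forall>i\<in>I. module.subspace s (A i)) \<and> (\<forall>x. \<exists>!f. decomposition I A f \<and> x = Sum_any f)"
  by (simp add: direct_sum_def decomposition_def conj_assoc)

lemma Sum_any_mem_subspace:
  assumes "Modules.module s" "module.subspace s W" "\<And>i. f i \<in> W"
  shows "Sum_any f \<in> W"
  unfolding Sum_any.expand_set by (rule module.subspace_sum[OF assms(1,2)]) (rule assms(3))

locale complex_vector_space = vector_space scale
  for scale :: "complex \<Rightarrow> 'a::ab_group_add \<Rightarrow> 'a"
begin

lemma decomposition_add: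
  assumes "\<And>i. i \<in> I \<Longrightarrow> subspace (A i)" "decomposition I A f" "decomposition I A g"
  shows "decomposition I A (\<lambda>i. f i + g i)"
    and "Sum_any (\<lambda>i. f i + g i) = Sum_any f + Sum_any g"
proof -
  have "finite ({i. f i \<noteq> 0} \<union> {i. g i \<noteq> 0})"
    using assms(2,3) by (simp add: decomposition_def)
  then have "finite {i. f i + g i \<noteq> 0}"
    by (rule rev_finite_subset) auto
  then show "decomposition I A (\<lambda>i. f i + g i)"
    using assms subspace_add unfolding decomposition_def by auto
  show "Sum_any (\<lambda>i. f i + g i) = Sum_any f + Sum_any g"
    using assms(2,3) by (intro Sum_any.distrib) (auto simp: decomposition_def)
qed

lemma decomposition_scale:
  assumes "\<And>i. i \<in> I \<Longrightarrow> subspace (A i)" "decomposition I A f"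
  shows "decomposition I A (\<lambda>i. scale c (f i))"
    and "Sum_any (\<lambda>i. scale c (f i)) = scale c (Sum_any f)"
proof -
  have fin: "finite {i. scale c (f i) \<noteq> 0}" "finite {i. f i \<noteq> 0}"
    using assms(2) finite_subset[of "{i. scale c (f i) \<noteq> 0}" "{i. f i \<noteq> 0}"]
    unfolding decomposition_def by auto
  then show "decomposition I A (\<lambda>i. scale c (f i))"
    using assms subspace_scale unfolding decomposition_def by auto
  show "Sum_any (\<lambda>i. scale c (f i)) = scale c (Sum_any f)"
    using fin Sum_any.expand_superset[of "{i. f i \<noteq> 0}" "\<lambda>i. scale c (f i)"]
    by (auto simp: Sum_any.expand_set[of f] scale_sum_right)
qed

lemma decomposition_diff:
  assumes "\<And>i. i \<in> I \<Longrightarrow> subspace (A i)" "decomposition I A f" "decomposition I A g"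
  shows "decomposition I A (\<lambda>i. f i - g i)"
    and "Sum_any (\<lambda>i. f i - g i) = Sum_any f - Sum_any g"
  using decomposition_add[OF assms(1,2) decomposition_scale(1)[OF assms(1,3), of "-1"]]
    decomposition_scale(2)[OF assms(1,3), of "-1"] by simp_all

lemma decomposition_single:
  assumes "\<And>i. i \<in> I \<Longrightarrow> subspace (A i)" "i \<in> I" "x \<in> A i"
  shows "decomposition I A (\<lambda>j. if j = i then x else 0)"
  using assms subspace_0 unfolding decomposition_def by auto

lemma direct_sum_exists:
  assumes "direct_sum scale I A"
  obtains f where "decomposition I A f" "x = Sum_any f"
  using assms unfolding direct_sum_alt by blast

lemma direct_sum_unique:
  assumes "direct_sum scale I A" "decomposition I A f" "decomposition I A g"
    "Sum_any f = Sum_any g"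
  shows "f = g"
  using assms unfolding direct_sum_alt by metis

lemma direct_sum_subspace: "direct_sum scale I A \<Longrightarrow> i \<in> I \<Longrightarrow> subspace (A i)"
  unfolding direct_sum_alt by blast

lemma direct_sum_induct [consumes 1, case_names homogeneous zero add]:
  assumes "direct_sum scale I A"
    and hom: "\<And>i x. i \<in> I \<Longrightarrow> x \<in> A i \<Longrightarrow> P x"
    and zero: "P 0" and add: "\<And>x y. P x \<Longrightarrow> P y \<Longrightarrow> P (x + y)"
  shows "P x"
proof -
  obtain f where f: "decomposition I A f" "x = Sum_any f"
    using direct_sum_exists[OF assms(1)] .
  have Pf: "P (f i)" for i
    using f(1) hom zero unfolding decomposition_def by metis
  have "P (sum f S)" for S
    by (induction S rule: infinite_finite_induct) (auto intro: zero add Pf)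
  then show ?thesis by (simp add: f(2) Sum_any.expand_set)
qed

lemma subspace_decomposable:
  assumes sub: "\<And>i. i \<in> I \<Longrightarrow> subspace (A i)" and U: "subspace U"
  shows "subspace {Sum_any f |f. decomposition I A f \<and> (\<forall>i. f i \<in> U)}" (is "subspace ?T")
proof (rule subspaceI)
  have "decomposition I A (\<lambda>i. 0)"
    using sub subspace_0 by (auto simp: decomposition_def)
  then show "0 \<in> ?T"
    using subspace_0[OF U] by (auto intro!: exI[of _ "\<lambda>i. 0"])
  fix x y c assume "x \<in> ?T"
  then obtain f where f: "decomposition I A f" "\<forall>i. f i \<in> U" "x = Sum_any f" by blast
  show "scale c x \<in> ?T"
    using decomposition_scale[OF sub f(1), of c] f subspace_scale[OF U]
    by (auto intro!: exI[of _ "\<lambda>i. scale c (f i)"])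
  assume "y \<in> ?T"
  then obtain g where g: "decomposition I A g" "\<forall>i. g i \<in> U" "y = Sum_any g" by blast
  show "x + y \<in> ?T"
    using decomposition_add[OF sub f(1) g(1)] f g subspace_add[OF U]
    by (auto intro!: exI[of _ "\<lambda>i. f i + g i"])
qed

lemma span_decomposable:
  assumes sub: "\<And>i. i \<in> I \<Longrightarrow> subspace (A i)" and S: "S \<subseteq> (\<Union>i\<in>I. A i)"
    and x: "x \<in> span S"
  obtains f where "decomposition I A f" "\<And>i. f i \<in> span S" "x = Sum_any f"
proof -
  let ?T = "{Sum_any f |f. decomposition I A f \<and> (\<forall>i. f i \<in> span S)}"
  have "S \<subseteq> ?T"
  proof
    fix y assume y: "y \<in> S"
    then obtain i where i: "i \<in> I" "y \<in> A i" using S by blast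
    have "decomposition I A (\<lambda>j. if j = i then y else 0)"
      using sub i by (rule decomposition_single)
    moreover have "Sum_any (\<lambda>j. if j = i then y else 0) = y" by simp
    ultimately show "y \<in> ?T"
      using span_base[OF y] span_zero
      by (auto intro!: exI[of _ "\<lambda>j. if j = i then y else 0"])
  qed
  then have "span S \<subseteq> ?T"
    by (rule span_minimal[OF _ subspace_decomposable[OF sub subspace_span]])
  then show ?thesis using x that by blast
qed

text \<open>
Adding the decompositions of elements of the span term by term keeps all components in the span,
and decompositions are unique.
\<close>

lemma homogeneous_span:
  assumes ds: "direct_sum scale I A" and S: "S \<subseteq> (\<Union>i\<in>I. A i)"
  shows "homogeneous I A (span S)"
  unfolding homogeneous_def
proof (intro allI impI)
  fix f i assume f: "decomposition I A f" "Sum_any f \<in> span S"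
  obtain g where "decomposition I A g" "\<And>i. g i \<in> span S" "Sum_any f = Sum_any g"
    using span_decomposable[OF direct_sum_subspace[OF ds] S f(2)] by metis
  then show "f i \<in> span S" using direct_sum_unique[OF ds f(1)] by metis
qed

lemma homogeneous_zero:
  assumes "direct_sum scale I A"
  shows "homogeneous I A {0}"
  using homogeneous_span[OF assms, of "{}"] by simp

text \<open>
A decomposition over \<open>I \<times> J\<close> is one over \<open>J\<close>, whose components are the column sums, followed by
one over \<open>I\<close> of each column; homogeneity is used once for each.  For \<open>W = {0}\<close> this is the
independence of the pieces of a bigrading.
\<close>

lemma homogeneous_product:
  assumes A: "\<And>i. i \<in> I \<Longrightarrow> subspace (A i)" and B: "\<And>j. j \<in> J \<Longrightarrow> subspace (B j)"
    and WA: "homogeneous I A W" and WB: "homogeneous J B W"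
  shows "homogeneous (I \<times> J) (\<lambda>(i, j). A i \<inter> B j) W"
  unfolding homogeneous_def
proof (intro allI impI)
  fix F k
  assume F: "decomposition (I \<times> J) (\<lambda>(i, j). A i \<inter> B j) F" and sum: "Sum_any F \<in> W"
  let ?G = "\<lambda>j. Sum_any (\<lambda>i. F (i, j))"
  have fin: "finite {k. F k \<noteq> 0}" using F by (simp add: decomposition_def)
  have fin1: "finite {i. \<exists>j. F (i, j) \<noteq> 0}"
    by (rule finite_subset[OF _ finite_imageI[OF fin, of fst]]) force
  have fin2: "finite {j. \<exists>i. F (i, j) \<noteq> 0}"
    by (rule finite_subset[OF _ finite_imageI[OF fin, of snd]]) force
  have zero: "F (i, j) = 0" if "i \<notin> I \<or> j \<notin> J" for i j
    using F that unfolding decomposition_def by auto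
  have mem: "F (i, j) \<in> A i" "F (i, j) \<in> B j" if "i \<in> I" "j \<in> J" for i j
    using F that unfolding decomposition_def by auto
  have col: "decomposition I A (\<lambda>i. F (i, j))" for j
    unfolding decomposition_def
  proof (intro conjI ballI allI impI)
    show "F (i, j) \<in> A i" if "i \<in> I" for i
      using mem(1) zero that subspace_0[OF A[OF that]] by (cases "j \<in> J") auto
    show "finite {i. F (i, j) \<noteq> 0}"
      by (rule finite_subset[OF _ fin1]) blast
  qed (use zero in blast)
  have "?G j \<in> B j" if "j \<in> J" for j
  proof (rule Sum_any_mem_subspace[OF module_axioms B[OF that]])
    show "F (i, j) \<in> B j" for i
      using mem(2) zero that subspace_0[OF B[OF that]] by (cases "i \<in> I") auto
  qed
  moreover have "?G j = 0" if "j \<notin> J" for j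
    using zero that by simp
  moreover have "finite {j. ?G j \<noteq> 0}"
    by (rule finite_subset[OF _ fin2]) (auto elim: Sum_any.not_neutral_obtains_not_neutral)
  ultimately have G: "decomposition J B ?G"
    unfolding decomposition_def by blast
  have "Sum_any ?G = Sum_any (\<lambda>i. Sum_any (\<lambda>j. F (i, j)))"
    using finite_cartesian_product[OF fin1 fin2] by (intro Sum_any.swap[symmetric]) auto
  also have "\<dots> = Sum_any (\<lambda>(i, j). F (i, j))"
    using finite_cartesian_product[OF fin1 fin2] by (intro Sum_any.cartesian_product) auto
  finally have "Sum_any ?G = Sum_any F" by simp
  with WB G sum have "?G j \<in> W" for j unfolding homogeneous_def by metis
  with WA col have "F (i, j) \<in> W" for i j unfolding homogeneous_def by blast
  then show "F k \<in> W" by (cases k) simp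
qed

lemma direct_sumI:
  assumes sub: "\<And>i. i \<in> I \<Longrightarrow> subspace (A i)"
    and ex: "\<And>x. x \<in> span (\<Union>i\<in>I. A i)" and zero: "homogeneous I A {0}"
  shows "direct_sum scale I A"
  unfolding direct_sum_alt
proof (intro conjI ballI allI ex_ex1I)
  fix x
  show "\<exists>f. decomposition I A f \<and> x = Sum_any f"
    using span_decomposable[OF sub order_refl ex[of x]] by metis
  fix f g
  assume "decomposition I A f \<and> x = Sum_any f" "decomposition I A g \<and> x = Sum_any g"
  then have "decomposition I A (\<lambda>i. f i - g i)" "Sum_any (\<lambda>i. f i - g i) = 0"
    using decomposition_diff[of I A f g, OF sub] by auto
  then show "f = g"
    using zero unfolding homogeneous_def by (auto simp: fun_eq_iff)
qed (rule sub)

text \<open>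
The \<open>I\<close>-components of an element of \<open>B j\<close> stay in \<open>B j\<close>, so they lie in the pieces of the
bigrading.
\<close>

lemma direct_sum_product:
  assumes A: "direct_sum scale I A" and B: "direct_sum scale J B"
    and BA: "\<And>j. j \<in> J \<Longrightarrow> homogeneous I A (B j)"
  shows "direct_sum scale (I \<times> J) (\<lambda>(i, j). A i \<inter> B j)"
proof (rule direct_sumI)
  note subA = direct_sum_subspace[OF A] and subB = direct_sum_subspace[OF B]
  show "subspace (case k of (i, j) \<Rightarrow> A i \<inter> B j)" if "k \<in> I \<times> J" for k
    using that subA subB by (auto intro: subspace_inter)
  show "homogeneous (I \<times> J) (\<lambda>(i, j). A i \<inter> B j) {0}"
    by (rule homogeneous_product[OF subA subB homogeneous_zero[OF A] homogeneous_zero[OF B]])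
  let ?S = "span (\<Union>k\<in>I \<times> J. case k of (i, j) \<Rightarrow> A i \<inter> B j)"
  show "x \<in> ?S" for x
    using B
  proof (induction x rule: direct_sum_induct)
    case (homogeneous j x)
    obtain f where f: "decomposition I A f" "x = Sum_any f"
      using direct_sum_exists[OF A] .
    have "f i \<in> B j" for i
      using BA[OF homogeneous(1)] f homogeneous(2) unfolding homogeneous_def by blast
    have "f i \<in> ?S" for i
    proof (cases "i \<in> I")
      case True
      then have "f i \<in> A i" using f(1) by (simp add: decomposition_def)
      then show ?thesis
        using True homogeneous(1) \<open>f i \<in> B j\<close> by (intro span_base UN_I[of "(i, j)"]) auto
    next
      case False
      then show ?thesis using f(1) span_zero by (simp add: decomposition_def)
    qed
    then show ?case
      unfolding f(2) by (rule Sum_any_mem_subspace[OF module_axioms subspace_span])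
  qed (auto intro: span_zero span_add)
qed

end

section \<open>Quotient of a vector space by a subspace\<close>

text \<open>
The product and the unit are parameters because the record type carries them: both \<open>R(V)\<close> with
its product and \<open>R(M)\<close> without one are instances.
\<close>

definition quotient_space ::
  "(complex \<Rightarrow> 'a::ab_group_add \<Rightarrow> 'a) \<Rightarrow> 'a set \<Rightarrow> ('a set \<Rightarrow> 'a set \<Rightarrow> 'a set) \<Rightarrow> 'a set \<Rightarrow>
   (complex, 'a set) module" where
  "quotient_space s W mu e =
     \<lparr>carrier = range (coset W), mult = mu, one = e,
      zero = W, add = induced2 W (+), smult = (\<lambda>c. induced W (s c))\<rparr>"

lemma quotient_simps [simp]:
  "carrier (quotient_space s W mu e) = range (coset W)"
  "mult (quotient_space s W mu e) = mu"
  "one (quotient_space s W mu e) = e"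
  "zero (quotient_space s W mu e) = W"
  by (simp_all add: quotient_space_def)

lemma R_module_quotient: "R_module s Y = quotient_space s (C2 s Y) undefined undefined"
  by (simp add: R_module_def quotient_space_def)

lemma R_algebra_quotient:
  "R_algebra s Y vac = quotient_space s (C2 s Y) (R_op s Y (-1)) (coset (C2 s Y) vac)"
  by (simp add: R_algebra_def R_module_def quotient_space_def)

lemma complex_ring_simps [simp]:
  "carrier complex_ring = UNIV" "mult complex_ring = (*)" "one complex_ring = 1"
  "zero complex_ring = 0" "add complex_ring = (+)"
  by (simp_all add: complex_ring_def)

lemma cring_complex_ring: "cring complex_ring"
proof (rule cringI)
  show "abelian_group complex_ring"
  proof (rule abelian_groupI)
    fix x assume "x \<in> carrier complex_ring"
    show "\<exists>y\<in>carrier complex_ring. y \<oplus>\<^bsub>complex_ring\<^esub> x = \<zero>\<^bsub>complex_ring\<^esub>"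
      by (simp, rule exI[of _ "- x"], simp)
  qed simp_all
  show "Group.comm_monoid complex_ring"
    by (rule comm_monoidI) simp_all
qed (simp add: algebra_simps)

locale subspace_quotient = complex_vector_space s
  for s :: "complex \<Rightarrow> 'a::ab_group_add \<Rightarrow> 'a" +
  fixes W :: "'a set"
  assumes subspace_W: "subspace W"
begin

lemma mem_coset: "y \<in> coset W x \<longleftrightarrow> y - x \<in> W"
  unfolding coset_def by (auto simp: image_iff intro: bexI[of _ "y - x"])

lemma coset_eq_iff: "coset W x = coset W y \<longleftrightarrow> x - y \<in> W"
proof
  assume "coset W x = coset W y"
  moreover have "x \<in> coset W x" by (simp add: mem_coset subspace_0[OF subspace_W])
  ultimately show "x - y \<in> W" using mem_coset by blast
next
  assume xy: "x - y \<in> W"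
  have "z - x \<in> W \<longleftrightarrow> z - y \<in> W" for z
    using subspace_add[OF subspace_W _ xy, of "z - x"] subspace_diff[OF subspace_W _ xy, of "z - y"]
    by auto
  then show "coset W x = coset W y" by (auto simp: mem_coset)
qed

lemma coset_zero: "coset W 0 = W"
  by (auto simp: mem_coset)

lemma coset_eq_W_iff: "coset W x = W \<longleftrightarrow> x \<in> W"
  using coset_eq_iff[of x 0] by (simp add: coset_zero)

lemma self_mem_coset: "x \<in> coset W x"
  by (simp add: mem_coset subspace_0[OF subspace_W])

end

lemma induced_coset:
  assumes "subspace_quotient s W" and "subspace_quotient t U"
    and lin: "Vector_Spaces.linear s t f" and maps: "\<And>x. x \<in> W \<Longrightarrow> f x \<in> U"
  shows "induced U f (coset W x) = coset U (f x)"
proof -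
  interpret V: subspace_quotient s W by fact
  interpret U: subspace_quotient t U by fact
  interpret f: Vector_Spaces.linear s t f by fact
  have "coset U (f x') = coset U (f x)" if "x' \<in> coset W x" for x'
    using maps[of "x' - x"] that by (simp add: U.coset_eq_iff V.mem_coset f.diff)
  then show ?thesis
    unfolding induced_def by (intro UN_constant_eq[OF V.self_mem_coset] ballI)
qed

lemma induced2_coset:
  assumes "subspace_quotient s1 W1" and "subspace_quotient s2 W2" and "subspace_quotient t U"
    and lin1: "\<And>y. Vector_Spaces.linear s1 t (\<lambda>x. f x y)"
    and lin2: "\<And>x. Vector_Spaces.linear s2 t (f x)"
    and maps1: "\<And>x y. x \<in> W1 \<Longrightarrow> f x y \<in> U"
    and maps2: "\<And>x y. y \<in> W2 \<Longrightarrow> f x y \<in> U"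
  shows "induced2 U f (coset W1 x) (coset W2 y) = coset U (f x y)"
proof -
  interpret V1: subspace_quotient s1 W1 by fact
  interpret V2: subspace_quotient s2 W2 by fact
  interpret U: subspace_quotient t U by fact
  have "coset U (f x' y') = coset U (f x y)" if "x' \<in> coset W1 x" "y' \<in> coset W2 y" for x' y'
  proof -
    interpret f1: Vector_Spaces.linear s1 t "\<lambda>x. f x y'" by (rule lin1)
    interpret f2: Vector_Spaces.linear s2 t "f x" by (rule lin2)
    have "f x' y' - f x y = f (x' - x) y' + f x (y' - y)"
      by (simp add: f1.diff f2.diff)
    moreover have "f (x' - x) y' + f x (y' - y) \<in> U"
      using that unfolding V1.mem_coset V2.mem_coset
      by (intro U.subspace_add[OF U.subspace_W] maps1 maps2)
    ultimately show ?thesis by (simp add: U.coset_eq_iff)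
  qed
  then show ?thesis
    unfolding induced2_def
    by (intro UN_constant_eq[OF V1.self_mem_coset] UN_constant_eq[OF V2.self_mem_coset] ballI)
qed

context subspace_quotient
begin

lemma quotient_add [simp]:
  "coset W x \<oplus>\<^bsub>quotient_space s W mu e\<^esub> coset W y = coset W (x + y)"
proof -
  have "coset W (x' + y') = coset W (x + y)" if "x' \<in> coset W x" "y' \<in> coset W y" for x' y'
    using subspace_add[OF subspace_W, of "x' - x" "y' - y"] that
    by (simp add: coset_eq_iff mem_coset algebra_simps)
  then have "(\<Union>x'\<in>coset W x. \<Union>y'\<in>coset W y. coset W (x' + y')) = coset W (x + y)"
    by (intro UN_constant_eq[OF self_mem_coset] ballI)
  then show ?thesis
    by (simp add: quotient_space_def induced2_def)
qed

lemma quotient_smult [simp]: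
  "c \<odot>\<^bsub>quotient_space s W mu e\<^esub> coset W x = coset W (s c x)"
proof -
  have "Vector_Spaces.linear s s (s c)"
    by (rule linear_scale_self)
  then show ?thesis
    using induced_coset[OF subspace_quotient_axioms subspace_quotient_axioms]
      subspace_scale[OF subspace_W]
    by (simp add: quotient_space_def)
qed

lemma abelian_group_quotient: "abelian_group (quotient_space s W mu e)"
proof (rule abelian_groupI)
  let ?Q = "quotient_space s W mu e"
  show "\<zero>\<^bsub>?Q\<^esub> \<in> carrier ?Q"
    using rangeI[of "coset W" 0] by (simp add: coset_zero)
  fix x assume "x \<in> carrier ?Q"
  then obtain a where a: "x = coset W a" by auto
  show "\<exists>y\<in>carrier ?Q. y \<oplus>\<^bsub>?Q\<^esub> x = \<zero>\<^bsub>?Q\<^esub>"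
    by (rule bexI[of _ "coset W (- a)"]) (simp_all add: a coset_zero)
  show "\<zero>\<^bsub>?Q\<^esub> \<oplus>\<^bsub>?Q\<^esub> x = x"
    using quotient_add[of mu e 0 a] by (simp add: a coset_zero)
  fix y assume "y \<in> carrier ?Q"
  then obtain b where b: "y = coset W b" by auto
  show "x \<oplus>\<^bsub>?Q\<^esub> y \<in> carrier ?Q" by (simp add: a b)
  show "x \<oplus>\<^bsub>?Q\<^esub> y = y \<oplus>\<^bsub>?Q\<^esub> x" by (simp add: a b add.commute)
  fix z assume "z \<in> carrier ?Q"
  then obtain c where c: "z = coset W c" by auto
  show "x \<oplus>\<^bsub>?Q\<^esub> y \<oplus>\<^bsub>?Q\<^esub> z = x \<oplus>\<^bsub>?Q\<^esub> (y \<oplus>\<^bsub>?Q\<^esub> z)" by (simp add: a b c add.assoc)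
qed

lemma module_quotient: "Module.module complex_ring (quotient_space s W mu e)"
proof (rule moduleI[OF cring_complex_ring abelian_group_quotient])
qed (auto simp: scale_left_distrib scale_right_distrib)

lemma quotient_uminus [simp]: "\<ominus>\<^bsub>quotient_space s W mu e\<^esub> coset W x = coset W (- x)"
proof -
  interpret Q: abelian_group "quotient_space s W mu e" by (rule abelian_group_quotient)
  show ?thesis
    by (rule Q.minus_equality) (simp_all add: coset_zero)
qed

lemma quotient_minus [simp]:
  "coset W x \<ominus>\<^bsub>quotient_space s W mu e\<^esub> coset W y = coset W (x - y)"
  by (simp add: a_minus_def)

lemma quotient_finsum:
  "finsum (quotient_space s W mu e) (\<lambda>i. coset W (f i)) S = coset W (sum f S)"
proof -
  interpret Q: abelian_group "quotient_space s W mu e" by (rule abelian_group_quotient)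
  show ?thesis
  proof (induction S rule: infinite_finite_induct)
    case (infinite S)
    then show ?case by (simp add: Q.finsum_infinite coset_zero)
  next
    case empty
    then show ?case by (simp add: coset_zero)
  next
    case (insert i S)
    then show ?case by (simp add: Q.finsum_insert)
  qed
qed

lemma submodule_quotient:
  assumes "subspace S"
  shows "submodule (coset W ` S) complex_ring (quotient_space s W mu e)"
proof (rule Module.module.submoduleI[OF module_quotient])
  show "\<zero>\<^bsub>quotient_space s W mu e\<^esub> \<in> coset W ` S"
    using imageI[OF subspace_0[OF assms], of "coset W"] by (simp add: coset_zero)
qed (use assms in \<open>auto intro!: imageI simp: subspace_neg subspace_add subspace_scale\<close>)

end

lemma linear_on_induced:
  assumes V: "subspace_quotient s W" and U: "subspace_quotient t U"
    and lin: "Vector_Spaces.linear s t f" and maps: "\<And>x. x \<in> W \<Longrightarrow> f x \<in> U"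
  shows "linear_on (quotient_space s W mu e) (quotient_space t U mu' e') (induced U f)"
proof -
  interpret V: subspace_quotient s W by fact
  interpret U: subspace_quotient t U by fact
  interpret f: Vector_Spaces.linear s t f by fact
  show ?thesis
    using induced_coset[OF V U lin maps]
    by (auto simp: linear_on_def f.add f.scale)
qed

lemma bilinear_on_induced2:
  assumes V1: "subspace_quotient s1 W1" and V2: "subspace_quotient s2 W2"
    and U: "subspace_quotient t U"
    and lin1: "\<And>y. Vector_Spaces.linear s1 t (\<lambda>x. f x y)"
    and lin2: "\<And>x. Vector_Spaces.linear s2 t (f x)"
    and maps1: "\<And>x y. x \<in> W1 \<Longrightarrow> f x y \<in> U"
    and maps2: "\<And>x y. y \<in> W2 \<Longrightarrow> f x y \<in> U"
  shows "bilinear_on (quotient_space s1 W1 mu1 e1) (quotient_space s2 W2 mu2 e2) (quotient_space t U mu e)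
    (induced2 U f)"
proof -
  interpret V1: subspace_quotient s1 W1 by fact
  interpret V2: subspace_quotient s2 W2 by fact
  interpret U: subspace_quotient t U by fact
  show ?thesis
    using induced2_coset[OF V1 V2 U lin1 lin2 maps1 maps2]
      module_hom.add[OF Vector_Spaces.linear.axioms(3)[OF lin1]]
      module_hom.scale[OF Vector_Spaces.linear.axioms(3)[OF lin1]]
      module_hom.add[OF Vector_Spaces.linear.axioms(3)[OF lin2]]
      module_hom.scale[OF Vector_Spaces.linear.axioms(3)[OF lin2]]
    by (auto simp: bilinear_on_def linear_on_def)
qed

context subspace_quotient
begin

text \<open>
Picking the representative \<open>0\<close> wherever \<open>F\<close> vanishes makes the support of the lift equal to that
of \<open>F\<close>, and so finite.
\<close>

lemma quotient_family_lift:
  assumes A: "\<And>i. i \<in> I \<Longrightarrow> subspace (A i)"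
    and F: "\<forall>i\<in>I. F i \<in> coset W ` A i" "\<forall>i. i \<notin> I \<longrightarrow> F i = W" "finite {i. F i \<noteq> W}"
  obtains f where "decomposition I A f" "F = (\<lambda>i. coset W (f i))"
    "finsum (quotient_space s W mu e) F {i. F i \<noteq> W} = coset W (Sum_any f)"
proof -
  have "\<exists>x. F i = coset W x \<and> (F i = W \<longrightarrow> x = 0) \<and> (i \<in> I \<longrightarrow> x \<in> A i)" for i
  proof (cases "F i = W")
    case True
    then show ?thesis using A subspace_0 coset_zero by auto
  next
    case False
    then show ?thesis using F(1,2) by (metis imageE)
  qed
  then obtain f where f: "\<And>i. F i = coset W (f i)" "\<And>i. F i = W \<Longrightarrow> f i = 0"
    "\<And>i. i \<in> I \<Longrightarrow> f i \<in> A i" by metis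
  have supp: "{i. f i \<noteq> 0} = {i. F i \<noteq> W}"
  proof -
    have "f i = 0 \<longleftrightarrow> F i = W" for i
      using f(1)[of i] f(2)[of i] coset_zero by auto
    then show ?thesis by simp
  qed
  have eq: "F = (\<lambda>i. coset W (f i))" using f(1) by blast
  show ?thesis
  proof (rule that[of f])
    show "decomposition I A f"
      using supp F(2,3) f(2,3) by (auto simp: decomposition_def)
    show "F = (\<lambda>i. coset W (f i))" by (rule eq)
    show "finsum (quotient_space s W mu e) F {i. F i \<noteq> W} = coset W (Sum_any f)"
      by (subst (1) eq) (simp add: quotient_finsum Sum_any.expand_set supp)
  qed
qed

text \<open>
The decomposition of a class is the image of the decomposition of a representative.  It is unique
because the difference of two lifts is a decomposition of an element of \<open>W\<close>, and by homogeneity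
its components lie in \<open>W\<close> again.
\<close>

lemma direct_sum_on_quotient:
  assumes ds: "direct_sum s I A" and hom: "homogeneous I A W"
  shows "direct_sum_on (quotient_space s W mu e) I (\<lambda>i. coset W ` A i)"
  unfolding direct_sum_on_def quotient_simps
proof (intro conjI ballI ex_ex1I)
  note sub = direct_sum_subspace[OF ds]
  show "submodule (coset W ` A i) complex_ring (quotient_space s W mu e)" if "i \<in> I" for i
    by (rule submodule_quotient[OF sub[OF that]])
  fix x assume "x \<in> range (coset W)"
  then obtain z where x: "x = coset W z" by blast
  obtain f where f: "decomposition I A f" "z = Sum_any f"
    using direct_sum_exists[OF ds] .
  let ?F = "\<lambda>i. coset W (f i)"
  have zero: "?F i = W" if "f i = 0" for i using that by (simp add: coset_zero)
  have supp: "{i. ?F i \<noteq> W} \<subseteq> {i. f i \<noteq> 0}" using zero by auto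
  have fin: "finite {i. f i \<noteq> 0}" using f(1) by (simp add: decomposition_def)
  have "sum f {i. f i \<noteq> 0} = sum f ({i. f i \<noteq> 0} - {i. ?F i \<noteq> W}) + sum f {i. ?F i \<noteq> W}"
    by (rule sum.subset_diff[OF supp fin])
  moreover have "sum f ({i. f i \<noteq> 0} - {i. ?F i \<noteq> W}) \<in> W"
    by (rule subspace_sum[OF subspace_W]) (auto simp: coset_eq_W_iff)
  ultimately have "x = coset W (sum f {i. ?F i \<noteq> W})"
    by (simp add: x f(2) Sum_any.expand_set coset_eq_iff)
  then have "x = finsum (quotient_space s W mu e) ?F {i. ?F i \<noteq> W}"
    by (simp add: quotient_finsum)
  then show "\<exists>F. (\<forall>i\<in>I. F i \<in> coset W ` A i) \<and> (\<forall>i. i \<notin> I \<longrightarrow> F i = W) \<and>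
      finite {i. F i \<noteq> W} \<and> x = finsum (quotient_space s W mu e) F {i. F i \<noteq> W}"
    using f(1) zero finite_subset[OF supp fin]
    by (intro exI[of _ ?F]) (auto simp: decomposition_def)
  fix F G
  assume F: "(\<forall>i\<in>I. F i \<in> coset W ` A i) \<and> (\<forall>i. i \<notin> I \<longrightarrow> F i = W) \<and>
      finite {i. F i \<noteq> W} \<and> x = finsum (quotient_space s W mu e) F {i. F i \<noteq> W}"
    and G: "(\<forall>i\<in>I. G i \<in> coset W ` A i) \<and> (\<forall>i. i \<notin> I \<longrightarrow> G i = W) \<and>
      finite {i. G i \<noteq> W} \<and> x = finsum (quotient_space s W mu e) G {i. G i \<noteq> W}"
  obtain f where f: "decomposition I A f" "F = (\<lambda>i. coset W (f i))" "x = coset W (Sum_any f)"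
    using quotient_family_lift[of I A F mu e, OF sub] F by metis
  obtain g where g: "decomposition I A g" "G = (\<lambda>i. coset W (g i))" "x = coset W (Sum_any g)"
    using quotient_family_lift[of I A G mu e, OF sub] G by metis
  have "Sum_any (\<lambda>i. f i - g i) \<in> W"
    using f(3) g(3) decomposition_diff(2)[OF sub f(1) g(1)] coset_eq_iff by metis
  then have "f i - g i \<in> W" for i
    using hom decomposition_diff(1)[OF sub f(1) g(1)] unfolding homogeneous_def by blast
  then show "F = G" by (simp add: f(2) g(2) coset_eq_iff fun_eq_iff)
qed

lemma complex_on_quotient:
  assumes "cochain_complex s G d" and hom: "homogeneous UNIV G W"
    and dW: "\<And>x. x \<in> W \<Longrightarrow> d x \<in> W"
  shows "complex_on (quotient_space s W mu e) (\<lambda>p. coset W ` G p) (induced W d)"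
proof -
  interpret C: cochain_complex s G d by fact
  note ind = induced_coset[OF subspace_quotient_axioms subspace_quotient_axioms C.d_linear dW]
  interpret Q: Module.module complex_ring "quotient_space s W mu e" by (rule module_quotient)
  show ?thesis
  proof
    show "direct_sum_on (quotient_space s W mu e) UNIV (\<lambda>p. coset W ` G p)"
      by (rule direct_sum_on_quotient[OF C.grading hom])
    show "linear_on (quotient_space s W mu e) (quotient_space s W mu e) (induced W d)"
      by (rule linear_on_induced[OF subspace_quotient_axioms subspace_quotient_axioms
            C.d_linear dW])
  qed (auto simp: ind C.d_square coset_zero intro: C.d_degree)
qed

end

section \<open>Consequences of the Jacobi identity\<close>

lemma zero_gchoose: "i \<noteq> 0 \<Longrightarrow> (0::complex) gchoose i = 0"
  by (cases i) simp_all

lemma Sum_any_eq_first: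
  fixes f :: "nat \<Rightarrow> 'a::comm_monoid_add"
  assumes "\<And>i. i \<noteq> 0 \<Longrightarrow> f i = 0"
  shows "Sum_any f = f 0"
proof -
  have "f i = (if i = 0 then f i else 0)" for i using assms by simp
  then have "Sum_any f = (\<Sum>i. if i = 0 then f i else 0)" by (rule Sum_any.cong)
  then show ?thesis by simp
qed

text \<open>
The finiteness of the support matters here: the sum over an infinite support is \<open>0\<close> by
convention, and would lose the first term.
\<close>

lemma (in vector_space) Sum_any_minus_first_mem:
  fixes f :: "nat \<Rightarrow> 'b"
  assumes W: "subspace W" and fin: "\<And>i. i \<ge> N \<Longrightarrow> f i = 0"
    and tail: "\<And>i. i > 0 \<Longrightarrow> f i \<in> W"
  shows "Sum_any f - f 0 \<in> W"
proof -
  have "i \<le> N" if "f i \<noteq> 0" for i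
    using fin[of i] that by (cases "i \<le> N") simp_all
  then have "Sum_any f = sum f {..N}"
    by (intro Sum_any.expand_superset) auto
  also have "\<dots> = f 0 + sum f {0<..N}"
    using sum.head[of 0 N f] by (simp add: atMost_atLeast0)
  finally have "Sum_any f - f 0 = sum f {0<..N}" by simp
  then show ?thesis
    using subspace_sum[OF W, of "{0<..N}" f] tail by auto
qed

context vertex_operators
begin

lemma mode_linear_simps:
  "YM v n (w + w') = YM v n w + YM v n w'" "YM v n 0 = 0" "YM v n (sM c w) = sM c (YM v n w)"
  "YM (v + v') n w = YM v n w + YM v' n w" "YM 0 n w = 0" "YM (sV c v) n w = sM c (YM v n w)"
proof -
  interpret r: Vector_Spaces.linear sM sM "YM v n" by (rule modes_linear)
  interpret l: Vector_Spaces.linear sV sM "\<lambda>v. YM v n w" by (rule modes_linear_left)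
  show "YM v n (w + w') = YM v n w + YM v n w'" "YM v n 0 = 0" "YM v n (sM c w) = sM c (YM v n w)"
  "YM (v + v') n w = YM v n w + YM v' n w" "YM 0 n w = 0" "YM (sV c v) n w = sM c (YM v n w)"
    by (simp_all add: r.add r.scale l.add l.scale)
qed

lemma mode_degree:
  assumes "v \<in> VG p" "w \<in> MG q"
  shows "YM v n w \<in> MG (p + q - 2 * n - 2)"
proof -
  have "YM v n w \<in> MG (q + (p - 2 * n - 2))"
    using modes_degree[OF assms(1), of n] assms(2) unfolding end_degree_def by blast
  then show ?thesis by (simp add: algebra_simps)
qed

lemma d_mode:
  "v \<in> VG p \<Longrightarrow> dM (YM v n w) = YM (dV v) n w + sM ((-1) powi p) (YM v n (dM w))"
  using modes_d[of v p n w] by simp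

text \<open>
The Jacobi identity for \<open>l = 0\<close>: on the left the binomial coefficients kill all terms but the
first.
\<close>

lemma commutator:
  assumes "u \<in> VG p" "v \<in> VG q"
  shows "YM u m (YM v n w) - sM ((-1) powi (p * q)) (YM v n (YM u m w)) =
    Sum_any (\<lambda>i. sM (of_int m gchoose i) (YM (Y u (int i) v) (m + n - int i) w))"
proof -
  show ?thesis
    using jacobi[OF assms, of 0 m n w]
    by (subst (asm) Sum_any_eq_first) (simp_all add: zero_gchoose)
qed

text \<open>
The Jacobi identity for \<open>m = 0\<close>: now it is the right-hand side that reduces to one term.
\<close>

lemma associativity:
  assumes "u \<in> VG p" "v \<in> VG q"
  shows "YM (Y u l v) n w =
    Sum_any (\<lambda>i. sM ((-1) ^ i * (of_int l gchoose i))
      (YM u (l - int i) (YM v (n + int i) w)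
       - sM ((-1) powi l * (-1) powi (p * q)) (YM v (n + l - int i) (YM u (int i) w))))"
proof -
  have "Sum_any (\<lambda>i. sM (of_int 0 gchoose i) (YM (Y u (l + int i) v) (0 + n - int i) w))
      = YM (Y u l v) n w"
    by (subst Sum_any_eq_first) (simp_all add: zero_gchoose)
  then show ?thesis
    using jacobi[OF assms, of l 0 n w] by simp
qed

end

section \<open>Modes modulo \<open>C\<^sub>2\<close>\<close>

text \<open>
With this, every congruence below that holds for a module also holds for the algebra.
\<close>

lemma (in dg_vertex_algebra) adjoint_dg_module: "dg_module sV VG dV Y vac sV VG dV Y"
  by (intro dg_module.intro dg_vertex_algebra_axioms vertex_operators_axioms)

context dg_module
begin

abbreviation CV where "CV \<equiv> C2 sV Y"
abbreviation CM where "CM \<equiv> C2 sM YM"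

lemma subspace_quotient_C2: "subspace_quotient sV CV" "subspace_quotient sM CM"
  by (unfold_locales; simp add: C2_def)+

text \<open>
The vector \<open>Y v (-2) vac\<close> is the translate of \<open>v\<close>, so by the usual derivative rule its mode \<open>n\<close> is
\<open>-n\<close> times the mode \<open>n - 1\<close> of \<open>v\<close>; only the fact that the factor is nonzero matters.
\<close>

lemma translation_mode:
  assumes "v \<in> VG p" "n \<le> -2"
  obtains c where "c \<noteq> 0" "YM (Y v (-2) vac) n w = sM c (YM v (n - 1) w)"
proof -
  \<comment> \<open>the summation index at which \<open>vac\<close> acts by its mode \<open>-1\<close>, the identity\<close>
  define k where "k = nat (- 1 - n)"
  have k: "int k = - 1 - n" using assms(2) by (simp add: k_def)
  define c :: complex where "c = (-1) ^ k * (of_int (-2) gchoose k)"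
  have "(- 2 :: complex) gchoose k = (-1) ^ k * (of_nat (k + 1) gchoose k)"
    using gbinomial_minus[of "2::complex" k] by (simp add: add.commute)
  also have "\<dots> \<noteq> 0"
    unfolding binomial_gbinomial[symmetric] using of_nat_neq_0[of k, where 'a = complex] by simp
  finally have "c \<noteq> 0" by (simp add: c_def)
  moreover have "YM (Y v (-2) vac) n w = sM c (YM v (n - 1) w)"
  proof -
    have "sM ((-1) ^ i * (of_int (-2) gchoose i))
        (YM v (-2 - int i) (YM vac (n + int i) w)
         - sM ((-1) powi (-2) * (-1) powi (p * 0)) (YM vac (n + -2 - int i) (YM v (int i) w)))
      = (if i = k then sM c (YM v (n - 1) w) else 0)" for i
    proof (cases "i = k")
      case True
      then have eqs: "n + int i = -1" "-2 - int i = n - 1" using k by simp_all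
      have "n + -2 - int i \<noteq> -1" using assms(2) by simp
      then show ?thesis
        using True unfolding eqs by (simp add: action.vacuum action.mode_linear_simps c_def)
    next
      case False
      then have "n + int i \<noteq> -1" using k by auto
      moreover have "n + -2 - int i \<noteq> -1" using assms(2) by simp
      ultimately show ?thesis
        using False by (simp add: action.vacuum action.mode_linear_simps)
    qed
    then show ?thesis
      unfolding action.associativity[OF assms(1) vac_degree] by simp
  qed
  ultimately show ?thesis by (rule that)
qed

lemma subspace_CM: "action.M.subspace CM"
  by (simp add: C2_def)

text \<open>
The modes of index below \<open>-2\<close> are, up to nonzero factors, modes of index \<open>-2\<close> of iterated
translates.  This is what makes almost every term of the commutator and associativity formulas
vanish modulo \<open>C\<^sub>2\<close>.
\<close>

lemma mode_mem_C2: "n \<le> -2 \<Longrightarrow> YM v n w \<in> CM"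
proof -
  have *: "YM v (- 2 - int k) w \<in> CM" if "v \<in> VG p" for k v p
    using that
  proof (induction k arbitrary: v p)
    case 0
    then show ?case by (auto simp: C2_def intro!: action.M.span_base)
  next
    case (Suc k)
    have "Y v (-2) vac \<in> VG (p + 2)"
      using mode_degree[OF Suc.prems vac_degree, of "-2"] by (simp add: add.commute)
    then have mem: "YM (Y v (-2) vac) (- 2 - int k) w \<in> CM" by (rule Suc.IH)
    obtain c where "c \<noteq> 0"
      and c: "YM (Y v (-2) vac) (- 2 - int k) w = sM c (YM v (- 2 - int k - 1) w)"
      by (rule translation_mode[OF Suc.prems, of "- 2 - int k" w]) simp
    then have "YM v (- 2 - int k - 1) w = sM (inverse c) (YM (Y v (-2) vac) (- 2 - int k) w)"
      by simp
    with mem have "YM v (- 2 - int k - 1) w \<in> CM"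
      using action.M.subspace_scale[OF subspace_CM] by simp
    then show ?case by (simp add: algebra_simps)
  qed
  assume n: "n \<le> -2"
  interpret V': complex_vector_space sV ..
  from V.grading show ?thesis
  proof (induction v rule: V'.direct_sum_induct)
    case (homogeneous p v)
    then show ?case using *[of v p "nat (- 2 - n)"] n by simp
  qed (simp_all add: action.mode_linear_simps action.M.subspace_0 action.M.subspace_add subspace_CM)
qed

text \<open>
Moving a mode of index \<open>n\<close> with \<open>n \<le> 0\<close> past a mode of index \<open>-2\<close> produces a term that begins with
that mode and commutator terms of index \<open>n - 2 - i \<le> -2\<close>.
\<close>

lemma mode_preserves_C2:
  assumes "n \<le> 0" "w \<in> CM"
  shows "YM u n w \<in> CM"
proof -
  interpret V': complex_vector_space sV ..
  interpret f: Vector_Spaces.linear sM sM "YM u n" by (rule action.modes_linear)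
  have "YM u n (YM v (-2) w) \<in> CM" for v w
    using V.grading
  proof (induction u rule: V'.direct_sum_induct)
    case (homogeneous p u)
    from V.grading show ?case
    proof (induction v rule: V'.direct_sum_induct)
      case (homogeneous q v)
      have "Sum_any (\<lambda>i. sM (of_int n gchoose i) (YM (Y u (int i) v) (n + -2 - int i) w)) \<in> CM"
        using assms(1)
        by (intro Sum_any_mem_subspace[OF action.M.module_axioms subspace_CM]
            action.M.subspace_scale[OF subspace_CM] mode_mem_C2) simp
      moreover have "sM ((-1) powi (p * q)) (YM v (-2) (YM u n w)) \<in> CM"
        by (intro action.M.subspace_scale[OF subspace_CM] mode_mem_C2) simp
      ultimately show ?case
        using action.M.subspace_add[OF subspace_CM]
          action.commutator[OF \<open>u \<in> VG p\<close> \<open>v \<in> VG q\<close>, of n "-2" w]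
        by (metis diff_add_cancel)
    qed (simp_all add: action.mode_linear_simps action.M.subspace_0 action.M.subspace_add subspace_CM)
  qed (simp_all add: action.mode_linear_simps action.M.subspace_0 action.M.subspace_add subspace_CM)
  then have "{YM v (-2) w |v w. True} \<subseteq> YM u n -` CM" by auto
  then have "CM \<subseteq> YM u n -` CM"
    by (subst (1) C2_def) (rule action.M.span_minimal[OF _ f.subspace_vimage[OF subspace_CM]])
  then show ?thesis using assms(2) by auto
qed

text \<open>
In the associativity formula for \<open>l = -2\<close> every term begins with a mode of index \<open>-2 - i\<close> or
\<open>n - 2 - i\<close>.
\<close>

lemma C2_mode:
  assumes "n \<le> 0" "u \<in> CV"
  shows "YM u n w \<in> CM"
proof -
  interpret V': complex_vector_space sV ..
  interpret f: Vector_Spaces.linear sV sM "\<lambda>u. YM u n w" by (rule action.modes_linear_left)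
  have "YM (Y u (-2) v) n w \<in> CM" for u v
    using V.grading
  proof (induction u rule: V'.direct_sum_induct)
    case (homogeneous p u)
    from V.grading show ?case
    proof (induction v rule: V'.direct_sum_induct)
      case (homogeneous q v)
      show ?case
        unfolding action.associativity[OF \<open>u \<in> VG p\<close> \<open>v \<in> VG q\<close>]
        using assms(1)
        by (intro Sum_any_mem_subspace[OF action.M.module_axioms subspace_CM]
            action.M.subspace_scale[OF subspace_CM] action.M.subspace_diff[OF subspace_CM] mode_mem_C2) simp_all
    qed (simp_all add: mode_linear_simps action.mode_linear_simps action.M.subspace_0 action.M.subspace_add subspace_CM)
  qed (simp_all add: mode_linear_simps action.mode_linear_simps action.M.subspace_0 action.M.subspace_add subspace_CM)
  then have "{Y u (-2) v |u v. True} \<subseteq> (\<lambda>u. YM u n w) -` CM" by auto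
  then have "CV \<subseteq> (\<lambda>u. YM u n w) -` CM"
    by (subst C2_def) (rule V.span_minimal[OF _ f.subspace_vimage[OF subspace_CM]])
  then show ?thesis using assms(2) by auto
qed

lemma d_preserves_C2:
  assumes "w \<in> CM"
  shows "dM w \<in> CM"
proof -
  interpret V': complex_vector_space sV ..
  interpret d: Vector_Spaces.linear sM sM dM by (rule action.M.d_linear)
  have "dM (YM v (-2) w) \<in> CM" for v w
    using V.grading
  proof (induction v rule: V'.direct_sum_induct)
    case (homogeneous p v)
    then show ?case
      by (simp add: action.d_mode mode_mem_C2 action.M.subspace_add action.M.subspace_scale subspace_CM)
  qed (simp_all add: action.mode_linear_simps d.add action.M.subspace_0 action.M.subspace_add
      subspace_CM)
  then have "{YM v (-2) w |v w. True} \<subseteq> dM -` CM" by auto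
  then have "CM \<subseteq> dM -` CM"
    by (subst (1) C2_def) (rule action.M.span_minimal[OF _ d.subspace_vimage[OF subspace_CM]])
  then show ?thesis using assms by auto
qed

text \<open>
A grading of the algebra and one of the module, in no relation to each other; the gradings by degree
and those by weight are both of interest.
\<close>

lemma C2_span_homogeneous:
  assumes "direct_sum sV I A" "direct_sum sM J B"
  shows "CM = action.M.span {YM v (-2) w |v w i j. i \<in> I \<and> v \<in> A i \<and> j \<in> J \<and> w \<in> B j}"
    (is "_ = action.M.span ?S")
proof
  interpret V': complex_vector_space sV ..
  interpret M': complex_vector_space sM ..
  have "YM v (-2) w \<in> action.M.span ?S" for v w
    using assms(1)
  proof (induction v rule: V'.direct_sum_induct)
    case (homogeneous i v)
    from assms(2) show ?case
    proof (induction w rule: M'.direct_sum_induct)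
      case (homogeneous j w)
      then show ?case using \<open>i \<in> I\<close> \<open>v \<in> A i\<close> by (blast intro: action.M.span_base)
    qed (simp_all add: action.mode_linear_simps action.M.span_zero action.M.span_add)
  qed (simp_all add: action.mode_linear_simps action.M.span_zero action.M.span_add)
  then show "CM \<subseteq> action.M.span ?S"
    unfolding C2_def by (intro action.M.span_minimal action.M.subspace_span) blast
  show "action.M.span ?S \<subseteq> CM"
    unfolding C2_def by (rule action.M.span_mono) blast
qed

lemma homogeneous_C2:
  assumes "direct_sum sV I A" "direct_sum sM J B"
    and "\<And>i v j w. i \<in> I \<Longrightarrow> v \<in> A i \<Longrightarrow> j \<in> J \<Longrightarrow> w \<in> B j \<Longrightarrow> \<exists>k\<in>J. YM v (-2) w \<in> B k"
  shows "homogeneous J B CM"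
proof -
  interpret M': complex_vector_space sM ..
  show ?thesis
    unfolding C2_span_homogeneous[OF assms(1,2)]
    using assms(3) by (intro M'.homogeneous_span[OF assms(2)]) fast
qed

lemma degree_homogeneous_C2: "homogeneous UNIV MG CM"
  by (rule homogeneous_C2[OF V.grading action.M.grading])
    (use action.mode_degree in blast)

text \<open>
For \<open>n = 0\<close> this is the Jacobi identity of the bracket, for \<open>n = -1\<close> its Leibniz rule; both hold
before passing to the quotient.
\<close>

lemma commutator_zero_mode:
  assumes "u \<in> VG p" "v \<in> VG q"
  shows "YM u 0 (YM v n w) = YM (Y u 0 v) n w + sM ((-1) powi (p * q)) (YM v n (YM u 0 w))"
proof -
  have "Sum_any (\<lambda>i. sM (of_int 0 gchoose i) (YM (Y u (int i) v) (0 + n - int i) w))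
    = YM (Y u 0 v) n w"
    by (subst Sum_any_eq_first) (simp_all add: zero_gchoose)
  then show ?thesis
    using action.commutator[OF assms, of 0 n w] by (simp add: algebra_simps)
qed

text \<open>
In the associativity formula for \<open>l = -1\<close> only the term \<open>i = 0\<close> survives modulo \<open>C\<^sub>2\<close>.  For
\<open>n = -1\<close> its second part lies in \<open>C\<^sub>2\<close> too, which leaves the associativity of the action; for
\<open>n = 0\<close> this is the Leibniz rule in the first argument of the bracket.
\<close>

lemma product_mode:
  assumes u: "u \<in> VG p" and v: "v \<in> VG q" and n: "n \<le> 0"
  shows "YM (Y u (-1) v) n w
    - (YM u (-1) (YM v n w) + sM ((-1) powi (p * q)) (YM v (n - 1) (YM u 0 w))) \<in> CM"
proof -
  let ?f = "\<lambda>i. sM ((-1) ^ i * (of_int (-1) gchoose i))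
      (YM u (-1 - int i) (YM v (n + int i) w)
       - sM ((-1) powi (-1) * (-1) powi (p * q)) (YM v (n + -1 - int i) (YM u (int i) w)))"
  obtain N1 where N1: "\<And>k. k \<ge> N1 \<Longrightarrow> YM u k w = 0"
    using action.truncation[of u w] by blast
  obtain N2 where N2: "\<And>k. k \<ge> N2 \<Longrightarrow> YM v k w = 0"
    using action.truncation[of v w] by blast
  have "?f i = 0" if "i \<ge> nat (max N1 (N2 - n))" for i
  proof -
    have "N1 \<le> int i" "N2 \<le> n + int i" using that by linarith+
    then show ?thesis by (simp add: N1 N2 action.mode_linear_simps)
  qed
  moreover have "?f i \<in> CM" if "i > 0" for i
    using that n
    by (intro action.M.subspace_scale[OF subspace_CM] action.M.subspace_diff[OF subspace_CM]
        mode_mem_C2) auto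
  ultimately have "Sum_any ?f - ?f 0 \<in> CM"
    by (rule action.M.Sum_any_minus_first_mem[OF subspace_CM])
  then show ?thesis
    unfolding action.associativity[OF u v] by (simp add: action.mode_linear_simps)
qed

lemma product_acts_associatively: "YM (Y u (-1) v) (-1) w - YM u (-1) (YM v (-1) w) \<in> CM"
proof -
  interpret V': complex_vector_space sV ..
  have add: "a + b - (c + d) \<in> CM" if "a - c \<in> CM" "b - d \<in> CM" for a b c d
    using action.M.subspace_add[OF subspace_CM that] by (simp add: algebra_simps)
  show ?thesis
    using V.grading
  proof (induction u rule: V'.direct_sum_induct)
    case (homogeneous p u)
    from V.grading show ?case
    proof (induction v rule: V'.direct_sum_induct)
      case (homogeneous q v)
      have rest: "sM ((-1) powi (p * q)) (YM v (-1 - 1) (YM u 0 w)) \<in> CM"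
        by (intro action.M.subspace_scale[OF subspace_CM] mode_mem_C2) simp
      show ?case
        using action.M.subspace_add[OF subspace_CM
            product_mode[OF \<open>u \<in> VG p\<close> \<open>v \<in> VG q\<close>, of "-1" w] rest]
        by (simp add: diff_diff_eq[symmetric])
    qed (simp_all add: mode_linear_simps action.mode_linear_simps action.M.subspace_0
        subspace_CM add)
  qed (simp_all add: mode_linear_simps action.mode_linear_simps action.M.subspace_0
      subspace_CM add)
qed

end

context dg_vertex_algebra
begin

text \<open>
Apply the commutator of two modes of index \<open>-1\<close> to the vacuum; it is a sum of modes of index at
most \<open>-2\<close>.
\<close>

lemma product_commutes:
  assumes "u \<in> VG p" "v \<in> VG q"
  shows "Y u (-1) v - sV ((-1) powi (p * q)) (Y v (-1) u) \<in> C2 sV Y"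
proof -
  interpret self: dg_module sV VG dV Y vac sV VG dV Y by (rule adjoint_dg_module)
  have "Sum_any (\<lambda>i. sV (of_int (-1) gchoose i) (Y (Y u (int i) v) (- 1 + - 1 - int i) vac))
      \<in> C2 sV Y"
    by (intro Sum_any_mem_subspace[OF V.module_axioms self.subspace_CM]
        V.subspace_scale[OF self.subspace_CM] self.mode_mem_C2) simp
  then show ?thesis
    unfolding commutator[OF assms, symmetric] by (simp add: creation)
qed

text \<open>
This is the Jacobi identity for \<open>l = 1\<close> and \<open>m = n = -1\<close>, applied to the vacuum.  On the left
the creation property leaves only \<open>u\<^sub>0v\<close> and, with its sign, \<open>v\<^sub>0u\<close>; on the right all modes have
index at most \<open>-2\<close>.
\<close>

lemma bracket_antisymmetric:
  assumes "u \<in> VG p" "v \<in> VG q"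
  shows "Y u 0 v + sV ((-1) powi (p * q)) (Y v 0 u) \<in> C2 sV Y"
proof -
  interpret self: dg_module sV VG dV Y vac sV VG dV Y by (rule adjoint_dg_module)
  let ?f = "\<lambda>i. sV ((-1) ^ i * (of_int 1 gchoose i))
        (Y u (- 1 + 1 - int i) (Y v (- 1 + int i) vac)
         - sV ((-1) powi 1 * (-1) powi (p * q)) (Y v (- 1 + 1 - int i) (Y u (- 1 + int i) vac)))"
  have "?f i = (if i = 0 then Y u 0 v + sV ((-1) powi (p * q)) (Y v 0 u) else 0)" for i
    by (simp add: creation mode_linear_simps)
  then have "Sum_any ?f = Y u 0 v + sV ((-1) powi (p * q)) (Y v 0 u)"
    by simp
  moreover have "Sum_any ?f =
      Sum_any (\<lambda>i. sV (of_int (-1) gchoose i) (Y (Y u (1 + int i) v) (- 1 + - 1 - int i) vac))"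
    by (rule jacobi[OF assms])
  moreover have "\<dots> \<in> C2 sV Y"
    by (intro Sum_any_mem_subspace[OF V.module_axioms self.subspace_CM]
        V.subspace_scale[OF self.subspace_CM] self.mode_mem_C2) simp
  ultimately show ?thesis by simp
qed

end

section \<open>The Poisson structures on the quotients\<close>

context dg_module
begin

lemma R_op_coset:
  assumes "n \<le> 0"
  shows "R_op sM YM n (coset CV v) (coset CM w) = coset CM (YM v n w)"
  unfolding R_op_def
  by (rule induced2_coset[OF subspace_quotient_C2(1,2,2) action.modes_linear_left
        action.modes_linear]) (auto intro: C2_mode[OF assms] mode_preserves_C2[OF assms])

lemma bilinear_on_R_op:
  assumes "n \<le> 0"
  shows "bilinear_on (quotient_space sV CV mu e) (quotient_space sM CM mu' e')
    (quotient_space sM CM mu' e') (R_op sM YM n)"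
  unfolding R_op_def
  by (rule bilinear_on_induced2[OF subspace_quotient_C2(1,2,2) action.modes_linear_left
        action.modes_linear]) (auto intro: C2_mode[OF assms] mode_preserves_C2[OF assms])

lemma induced_d_coset: "induced CM dM (coset CM w) = coset CM (dM w)"
  by (rule induced_coset[OF subspace_quotient_C2(2,2) action.M.d_linear d_preserves_C2])

lemma complex_on_R:
  "complex_on (quotient_space sM CM mu e) (\<lambda>p. R_image sM YM (MG p)) (induced CM dM)"
  unfolding R_image_def
  by (rule subspace_quotient.complex_on_quotient[OF subspace_quotient_C2(2)
        action.M.cochain_complex_axioms degree_homogeneous_C2 d_preserves_C2])

end

lemma (in dg_vertex_algebra) dg_poisson_algebra_R:
  "dg_poisson_algebra (R_algebra sV Y vac) (\<lambda>p. R_image sV Y (VG p)) (induced (C2 sV Y) dV)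
    (-2) (R_op sV Y 0)"
proof -
  interpret self: dg_module sV VG dV Y vac sV VG dV Y by (rule adjoint_dg_module)
  interpret Q: subspace_quotient sV self.CV by (rule self.subspace_quotient_C2)
  note simps [simp] = self.R_op_coset self.induced_d_coset Q.coset_eq_iff
  let ?R = "R_algebra sV Y vac"
  have cpx: "complex_on ?R (\<lambda>p. R_image sV Y (VG p)) (induced self.CV dV)"
    unfolding R_algebra_quotient by (rule self.complex_on_R)
  have ring: "ring ?R"
    unfolding R_algebra_quotient
  proof (rule ringI[OF Q.abelian_group_quotient])
    let ?Q = "quotient_space sV self.CV (R_op sV Y (- 1)) (coset self.CV vac)"
    show "Group.monoid ?Q"
    proof (rule monoidI)
      fix x y z assume "x \<in> carrier ?Q" "y \<in> carrier ?Q" "z \<in> carrier ?Q"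
      then obtain a b c where "x = coset self.CV a" "y = coset self.CV b" "z = coset self.CV c"
        by auto
      then show "x \<otimes>\<^bsub>?Q\<^esub> y \<otimes>\<^bsub>?Q\<^esub> z = x \<otimes>\<^bsub>?Q\<^esub> (y \<otimes>\<^bsub>?Q\<^esub> z)"
        by (simp add: self.product_acts_associatively)
    qed (auto simp: vacuum creation V.subspace_0 self.subspace_CM)
  qed (auto simp: mode_linear_simps V.subspace_0 self.subspace_CM)
  show ?thesis
  proof (intro dg_poisson_algebra.intro dg_algebra.intro dg_algebra_axioms.intro
      dg_poisson_algebra_axioms.intro cpx ring, unfold R_algebra_quotient)
    let ?Q = "quotient_space sV self.CV (R_op sV Y (- 1)) (coset self.CV vac)"
    show "bilinear_on ?Q ?Q ?Q (\<lambda>a b. a \<otimes>\<^bsub>?Q\<^esub> b)"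
      using self.bilinear_on_R_op[of "-1"] by simp
    show "bilinear_on ?Q ?Q ?Q (R_op sV Y 0)"
      by (rule self.bilinear_on_R_op) simp
    show "\<one>\<^bsub>?Q\<^esub> \<in> R_image sV Y (VG 0)"
      by (simp add: R_image_def vac_degree del: Q.coset_eq_iff)
    show "even (-2 :: int)" by simp
    fix a b p q assume "a \<in> R_image sV Y (VG p)" "b \<in> R_image sV Y (VG q)"
    then obtain u v where u: "u \<in> VG p" "a = coset self.CV u" and v: "v \<in> VG q" "b = coset self.CV v"
      unfolding R_image_def by blast
    show "a \<otimes>\<^bsub>?Q\<^esub> b \<in> R_image sV Y (VG (p + q))"
      using mode_degree[OF u(1) v(1), of "-1"] by (simp add: u(2) v(2) R_image_def del: Q.coset_eq_iff)
    show "R_op sV Y 0 a b \<in> R_image sV Y (VG (p + q + -2))"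
      using mode_degree[OF u(1) v(1), of 0] by (simp add: u(2) v(2) R_image_def del: Q.coset_eq_iff)
    show "induced self.CV dV (a \<otimes>\<^bsub>?Q\<^esub> b) = induced self.CV dV a \<otimes>\<^bsub>?Q\<^esub> b \<oplus>\<^bsub>?Q\<^esub>
        (- 1) powi p \<odot>\<^bsub>?Q\<^esub> (a \<otimes>\<^bsub>?Q\<^esub> induced self.CV dV b)"
      by (simp add: u(2) v(2) d_mode[OF u(1)] V.subspace_0 self.subspace_CM)
    show "induced self.CV dV (R_op sV Y 0 a b) = R_op sV Y 0 (induced self.CV dV a) b \<oplus>\<^bsub>?Q\<^esub>
        (- 1) powi p \<odot>\<^bsub>?Q\<^esub> R_op sV Y 0 a (induced self.CV dV b)"
      by (simp add: u(2) v(2) d_mode[OF u(1)] V.subspace_0 self.subspace_CM)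
    show "a \<otimes>\<^bsub>?Q\<^esub> b = (- 1) powi (p * q) \<odot>\<^bsub>?Q\<^esub> (b \<otimes>\<^bsub>?Q\<^esub> a)"
      using product_commutes[OF u(1) v(1)] by (simp add: u(2) v(2))
    show "R_op sV Y 0 a b = \<ominus>\<^bsub>?Q\<^esub> ((- 1) powi (p * q) \<odot>\<^bsub>?Q\<^esub> R_op sV Y 0 b a)"
      using bracket_antisymmetric[OF u(1) v(1)] by (simp add: u(2) v(2))
    fix c r assume "c \<in> R_image sV Y (VG r)"
    then obtain w where w: "c = coset self.CV w"
      unfolding R_image_def by blast
    show "R_op sV Y 0 (R_op sV Y 0 a b) c = R_op sV Y 0 a (R_op sV Y 0 b c) \<ominus>\<^bsub>?Q\<^esub>
        (- 1) powi (p * q) \<odot>\<^bsub>?Q\<^esub> R_op sV Y 0 b (R_op sV Y 0 a c)"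
      using self.commutator_zero_mode[OF u(1) v(1), of 0 w]
      by (simp add: u(2) v(2) w V.subspace_0 self.subspace_CM)
    show "R_op sV Y 0 a (b \<otimes>\<^bsub>?Q\<^esub> c) = R_op sV Y 0 a b \<otimes>\<^bsub>?Q\<^esub> c \<oplus>\<^bsub>?Q\<^esub>
        (- 1) powi (p * q) \<odot>\<^bsub>?Q\<^esub> (b \<otimes>\<^bsub>?Q\<^esub> R_op sV Y 0 a c)"
      using self.commutator_zero_mode[OF u(1) v(1), of "-1" w]
      by (simp add: u(2) v(2) w V.subspace_0 self.subspace_CM)
  qed
qed

context dg_module
begin

lemma dg_poisson_module_R:
  "dg_poisson_module
     (R_algebra sV Y vac) (\<lambda>p. R_image sV Y (VG p)) (induced CV dV) (-2) (R_op sV Y 0)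
     (R_module sM YM) (\<lambda>p. R_image sM YM (MG p)) (induced CM dM)
     (R_op sM YM (-1)) (R_op sM YM 0)"
proof -
  interpret self: dg_module sV VG dV Y vac sV VG dV Y by (rule adjoint_dg_module)
  interpret MQ: subspace_quotient sM CM by (rule subspace_quotient_C2)
  note simps [simp] = self.R_op_coset self.induced_d_coset R_op_coset induced_d_coset
    MQ.coset_eq_iff action.M.subspace_0[OF subspace_CM]
  let ?M = "R_module sM YM"
  have cpx: "complex_on ?M (\<lambda>p. R_image sM YM (MG p)) (induced CM dM)"
    unfolding R_module_quotient by (rule complex_on_R)
  show ?thesis
  proof (intro dg_poisson_module.intro dg_poisson_module_axioms.intro cpx
      dg_poisson_algebra_R, unfold R_algebra_quotient R_module_quotient)
    let ?R = "quotient_space sV CV (R_op sV Y (- 1)) (coset CV vac)"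
    let ?Q = "quotient_space sM CM undefined undefined"
    show "bilinear_on ?R ?Q ?Q (R_op sM YM (-1))" "bilinear_on ?R ?Q ?Q (R_op sM YM 0)"
      by (rule bilinear_on_R_op; simp)+
    show "R_op sM YM (- 1) \<one>\<^bsub>?R\<^esub> x = x" if "x \<in> carrier ?Q" for x
      using that by (auto simp: action.vacuum)
    show "R_op sM YM (- 1) (a \<otimes>\<^bsub>?R\<^esub> b) x = R_op sM YM (- 1) a (R_op sM YM (- 1) b x)"
      if abx: "a \<in> carrier ?R" "b \<in> carrier ?R" "x \<in> carrier ?Q" for a b x
    proof -
      obtain u v w where "a = coset CV u" "b = coset CV v" "x = coset CM w" using abx by auto
      then show ?thesis by (simp add: product_acts_associatively)
    qed
    fix a p assume "a \<in> R_image sV Y (VG p)"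
    then obtain u where u: "u \<in> VG p" "a = coset CV u"
      unfolding R_image_def by blast
    show "R_op sM YM (- 1) a x \<in> R_image sM YM (MG (p + q))"
      "R_op sM YM 0 a x \<in> R_image sM YM (MG (p + q + -2))"
      "induced CM dM (R_op sM YM (- 1) a x) = R_op sM YM (- 1) (induced CV dV a) x \<oplus>\<^bsub>?Q\<^esub>
        (- 1) powi p \<odot>\<^bsub>?Q\<^esub> R_op sM YM (- 1) a (induced CM dM x)"
      "induced CM dM (R_op sM YM 0 a x) = R_op sM YM 0 (induced CV dV a) x \<oplus>\<^bsub>?Q\<^esub>
        (- 1) powi p \<odot>\<^bsub>?Q\<^esub> R_op sM YM 0 a (induced CM dM x)"
      if x: "x \<in> R_image sM YM (MG q)" for x q
    proof -
      obtain w where w: "w \<in> MG q" "x = coset CM w"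
        using x unfolding R_image_def by blast
      show "R_op sM YM (- 1) a x \<in> R_image sM YM (MG (p + q))"
        "R_op sM YM 0 a x \<in> R_image sM YM (MG (p + q + -2))"
        using action.mode_degree[OF u(1) w(1), of "-1"] action.mode_degree[OF u(1) w(1), of 0]
        by (simp_all add: u(2) w(2) R_image_def del: MQ.coset_eq_iff)
      show "induced CM dM (R_op sM YM (- 1) a x) = R_op sM YM (- 1) (induced CV dV a) x \<oplus>\<^bsub>?Q\<^esub>
          (- 1) powi p \<odot>\<^bsub>?Q\<^esub> R_op sM YM (- 1) a (induced CM dM x)"
        "induced CM dM (R_op sM YM 0 a x) = R_op sM YM 0 (induced CV dV a) x \<oplus>\<^bsub>?Q\<^esub>
          (- 1) powi p \<odot>\<^bsub>?Q\<^esub> R_op sM YM 0 a (induced CM dM x)"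
        by (simp_all add: u(2) w(2) action.d_mode[OF u(1)])
    qed
    fix b q assume "b \<in> R_image sV Y (VG q)"
    then obtain v where v: "v \<in> VG q" "b = coset CV v"
      unfolding R_image_def by blast
    fix x r assume "x \<in> R_image sM YM (MG r)"
    then obtain w where w: "x = coset CM w"
      unfolding R_image_def by blast
    show "R_op sM YM 0 (R_op sV Y 0 a b) x = R_op sM YM 0 a (R_op sM YM 0 b x) \<ominus>\<^bsub>?Q\<^esub>
        (- 1) powi (p * q) \<odot>\<^bsub>?Q\<^esub> R_op sM YM 0 b (R_op sM YM 0 a x)"
      using commutator_zero_mode[OF u(1) v(1), of 0 w] by (simp add: u(2) v(2) w)
    show "R_op sM YM 0 a (R_op sM YM (- 1) b x) = R_op sM YM (- 1) (R_op sV Y 0 a b) x \<oplus>\<^bsub>?Q\<^esub>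
        (- 1) powi (p * q) \<odot>\<^bsub>?Q\<^esub> R_op sM YM (- 1) b (R_op sM YM 0 a x)"
      using commutator_zero_mode[OF u(1) v(1), of "-1" w] by (simp add: u(2) v(2) w)
    show "R_op sM YM 0 (a \<otimes>\<^bsub>?R\<^esub> b) x = R_op sM YM (- 1) a (R_op sM YM 0 b x) \<oplus>\<^bsub>?Q\<^esub>
        (- 1) powi (p * q) \<odot>\<^bsub>?Q\<^esub> R_op sM YM (- 1) b (R_op sM YM 0 a x)"
      using product_mode[OF u(1) v(1), of 0 w] by (simp add: u(2) v(2) w)
  qed
qed

end

section \<open>Weights\<close>

lemma half_ints_shift:
  assumes "n \<in> half_ints" "r \<in> half_ints"
  shows "r + n - of_int m - 1 \<in> half_ints"
proof -
  have "2 * (r + n - of_int m - 1) = 2 * r + 2 * n - of_int (2 * m + 2)"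
    by simp
  then show ?thesis
    using assms by (simp add: half_ints_def)
qed

context graded_dg_module
begin

text \<open>
The vectors \<open>v\<close> may be taken homogeneous for the weight alone: the grading of \<open>C\<^sub>2\<close> by weight and
the one by degree are established separately and then combined.
\<close>

lemma weight_homogeneous_C2: "homogeneous half_ints MW CM"
proof (rule homogeneous_C2[OF weight_decomposition MW_decomposition])
  fix n v r w assume "n \<in> half_ints" "v \<in> weight_space sV Y \<omega> n" "r \<in> half_ints" "w \<in> MW r"
  then show "\<exists>k\<in>half_ints. YM v (-2) w \<in> MW k"
    using MW_modes[of n r v "-2"] half_ints_shift[of n r "-2"] by blast
qed

lemma degree_homogeneous_MW:
  assumes "r \<in> half_ints"
  shows "homogeneous UNIV MG (MW r)"
proof -
  interpret M': complex_vector_space sM ..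
  have "action.M.span (\<Union>p. MW r \<inter> MG p) \<subseteq> MW r"
    using M'.direct_sum_subspace[OF MW_decomposition assms] by (intro action.M.span_minimal) blast
  then have "MW r = action.M.span (\<Union>p. MW r \<inter> MG p)"
    using MW_graded[OF assms] by blast
  moreover have "homogeneous UNIV MG (action.M.span (\<Union>p. MW r \<inter> MG p))"
    by (rule M'.homogeneous_span[OF action.M.grading]) blast
  ultimately show ?thesis by simp
qed

text \<open>
Both gradings of the module are compatible with \<open>C\<^sub>2\<close>, and the weight pieces are graded by degree,
so the pieces of the common refinement descend to the quotient.
\<close>

lemma bigraded_module_R:
  "bigraded_module (\<lambda>p n. R_image sV Y (weight_space sV Y \<omega> n \<inter> VG p))
     (R_module sM YM) (\<lambda>p n. R_image sM YM (MG p \<inter> MW n)) (R_op sM YM (-1))"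
  unfolding bigraded_module_def
proof (intro conjI allI ballI)
  interpret M': complex_vector_space sM ..
  have "direct_sum_on (quotient_space sM CM undefined undefined) (UNIV \<times> half_ints)
      (\<lambda>k. coset CM ` (case k of (p, n) \<Rightarrow> MG p \<inter> MW n))"
  proof (rule subspace_quotient.direct_sum_on_quotient[OF subspace_quotient_C2(2)])
    show "direct_sum sM (UNIV \<times> half_ints) (\<lambda>(p, n). MG p \<inter> MW n)"
      by (rule M'.direct_sum_product[OF action.M.grading MW_decomposition degree_homogeneous_MW])
    show "homogeneous (UNIV \<times> half_ints) (\<lambda>(p, n). MG p \<inter> MW n) CM"
      by (rule M'.homogeneous_product[OF M'.direct_sum_subspace[OF action.M.grading]
            M'.direct_sum_subspace[OF MW_decomposition] degree_homogeneous_C2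
            weight_homogeneous_C2])
  qed
  then show "direct_sum_on (R_module sM YM) (UNIV \<times> half_ints)
      (\<lambda>(p, n). R_image sM YM (MG p \<inter> MW n))"
    by (simp add: R_module_quotient R_image_def case_prod_unfold)
  fix p p' n n' a x
  assume n: "n \<in> half_ints" "n' \<in> half_ints"
    and "a \<in> R_image sV Y (weight_space sV Y \<omega> n \<inter> VG p)" "x \<in> R_image sM YM (MG p' \<inter> MW n')"
  then obtain u w where u: "u \<in> weight_space sV Y \<omega> n" "u \<in> VG p" "a = coset CV u"
    and w: "w \<in> MG p'" "w \<in> MW n'" "x = coset CM w"
    unfolding R_image_def by blast
  have "YM u (-1) w \<in> MG (p + p')"
    using action.mode_degree[OF u(2) w(1), of "-1"] by simp
  moreover have "YM u (-1) w \<in> MW (n + n')"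
    using MW_modes[OF n u(1), of "-1"] w(2) by (auto simp: add.commute)
  ultimately show "R_op sM YM (-1) a x \<in> R_image sM YM (MG (p + p') \<inter> MW (n + n'))"
    by (simp add: u(3) w(3) R_op_coset R_image_def)
qed

end

theorem theorem5p3:
  fixes sV :: "complex \<Rightarrow> 'v::ab_group_add \<Rightarrow> 'v"
    and VG :: "int \<Rightarrow> 'v set" and dV :: "'v \<Rightarrow> 'v"
    and Y :: "'v \<Rightarrow> int \<Rightarrow> 'v \<Rightarrow> 'v" and vac :: 'v
    and sM :: "complex \<Rightarrow> 'm::ab_group_add \<Rightarrow> 'm"
    and MG :: "int \<Rightarrow> 'm set" and dM :: "'m \<Rightarrow> 'm"
    and YM :: "'v \<Rightarrow> int \<Rightarrow> 'm \<Rightarrow> 'm"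
  assumes "dg_module sV VG dV Y vac sM MG dM YM"
  shows
    "(\<forall>v m. R_op sM YM (-1) (coset (C2 sV Y) v) (coset (C2 sM YM) m)
              = coset (C2 sM YM) (YM v (-1) m)) \<and>
     (\<forall>v m. R_op sM YM 0 (coset (C2 sV Y) v) (coset (C2 sM YM) m)
              = coset (C2 sM YM) (YM v 0 m)) \<and>
     dg_poisson_module
       (R_algebra sV Y vac) (\<lambda>p. R_image sV Y (VG p)) (induced (C2 sV Y) dV)
       (-2) (R_op sV Y 0)
       (R_module sM YM) (\<lambda>p. R_image sM YM (MG p)) (induced (C2 sM YM) dM)
       (R_op sM YM (-1)) (R_op sM YM 0) \<and>
     (\<forall>\<omega> MW. dg_vertex_operator_algebra sV VG dV Y vac \<omega> \<longrightarrow>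
        graded_dg_module sV VG dV Y vac \<omega> sM MG dM YM MW \<longrightarrow>
        bigraded_module
          (\<lambda>p n. R_image sV Y (weight_space sV Y \<omega> n \<inter> VG p))
          (R_module sM YM) (\<lambda>p n. R_image sM YM (MG p \<inter> MW n))
          (R_op sM YM (-1)))"
proof -
  interpret dg_module sV VG dV Y vac sM MG dM YM by fact
  show ?thesis
    by (intro conjI allI impI dg_poisson_module_R graded_dg_module.bigraded_module_R)
      (simp_all add: R_op_coset)
qed

end
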